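(* Let $\phi(x)$ be a real polynomial of degree $2q+1$ with odd powers only, such that $\phi(\Sigma_k)$ is nonsingular. If $\operatorname{rank}(V_k^TX)=k$, then $$|\sin\Theta(\mathcal{K}_q,u_i)|\le\frac{\|\phi(\Sigma_{k,\perp})\|_2}{|\phi(\sigma_i)|}\,\|V_{k,\perp}^TX(V_k^TX)^{\dagger}\|_2,\qquad 1\le i\le k.$$ If, in addition, $X$ has orthonormal columns, then $$|\sin\Theta(\mathcal{K}_q,u_i)|\le\frac{\|\phi(\Sigma_{k,\perp})\|_2}{|\phi(\sigma_i)|}\,\|\tan\Theta(X,V_k)\|_2,\qquad 1\le i\le k.$$
   Context: Setting. $A\in\mathbb{R}^{m\times n}$, $X\in\mathbb{R}^{n\times s}$, $q\ge 0$ is an integer, and $$\mathcal{K}_q=\operatorname{range}\begin{pmatrix}AX&(AA^T)AX&\cdots&(AA^T)^qAX\end{pmatrix}\subseteq\mathbb{R}^m,$$ which is assumed to have maximal dimension $\dim\mathcal{K}_q=(q+1)s$. Let $A=U\Sigma V^T$ be a full SVD, with $U\in\mathbb{R}^{m\times m}$, $V\in\mathbb{R}^{n\times n}$ orthogonal and $\Sigma\in\mathbb{R}^{m\times n}$ diagonal with singular values $\sigma_1\ge\sigma_2\ge\cdots\ge 0$. Let $1\le k<\operatorname{rank}(A)$ and partition $\Sigma=\begin{pmatrix}\Sigma_k&\\&\Sigma_{k,\perp}\end{pmatrix}$, $U=\begin{pmatrix}U_k&U_{k,\perp}\end{pmatrix}$, $V=\begin{pmatrix}V_k&V_{k,\perp}\end{pmatrix}$,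 where $\Sigma_k=\operatorname{diag}(\sigma_1,\dots,\sigma_k)$, $U_k=\begin{pmatrix}u_1&\cdots&u_k\end{pmatrix}$, and $V_k$ has $k$ columns. It is assumed that $\sigma_k>\sigma_{k+1}>0$. Notation. For a rectangular diagonal matrix $D$, $\phi(D)$ is the diagonal matrix of the same dimensions obtained by applying $\phi$ to the diagonal entries only. $\|\cdot\|_2$ is the spectral norm; the superscript $\dagger$ is the Moore-Penrose inverse. Principal angles. Let $\mathcal{S},\mathcal{W}$ be subspaces of the same Euclidean space with $\dim\mathcal{W}=\ell\le\dim\mathcal{S}$, and let $Q$ and $W$ be matrices whose columns are orthonormal bases of $\mathcal{S}$ and $\mathcal{W}$. The principal angles $0\le\theta_1\le\cdots\le\theta_\ell\le\pi/2$ are given by $\cos\theta_j=\sigma_j(W^TQ)$, and $\Theta(\mathcal{S},\mathcal{W})=\operatorname{diag}(\theta_1,\dots,\theta_\ell)$. A matrix or vector used as an argument of $\Theta$ stands for its range (span); in particular $\Theta(\mathcal{K}_q,u_i)$ is a single angle. $\tan\Theta$ is applied to each diagonal angle and is used only when all angles are less than $\pi/2$. *)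

theory Defs
  imports "Jordan_Normal_Form.DL_Rank"
begin

text \<open>Vectors and matrices are those of the AFP entry Jordan-Normal-Form; row, column and
  diagonal indices start at 0, so \<open>\<sigma>\<^sub>1, u\<^sub>1\<close> become \<open>\<Sigma> $$ (0,0)\<close>, \<open>col U 0\<close>.\<close>

abbreviation vec_span :: "nat \<Rightarrow> real vec set \<Rightarrow> real vec set" where
  "vec_span m B \<equiv> LinearCombinations.module.span class_ring (module_vec TYPE(real) m) B"

abbreviation mat_range :: "real mat \<Rightarrow> real vec set" where
  "mat_range M \<equiv> vec_space.col_space (dim_row M) M"

abbreviation subspace_dim :: "nat \<Rightarrow> real vec set \<Rightarrow> nat" where
  "subspace_dim m S \<equiv> vectorspace.dim class_ring (module_vec TYPE(real) m\<lparr>carrier := S\<rparr>)"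

definition vec_norm2 :: "real vec \<Rightarrow> real" where
  "vec_norm2 v = sqrt (v \<bullet> v)"

definition spectral_norm :: "real mat \<Rightarrow> real" where
  "spectral_norm M = (SUP v \<in> {v \<in> carrier_vec (dim_col M). vec_norm2 v \<le> 1}. vec_norm2 (M *\<^sub>v v))"

definition is_pinv :: "real mat \<Rightarrow> real mat \<Rightarrow> bool" where
  "is_pinv M P \<longleftrightarrow> P \<in> carrier_mat (dim_col M) (dim_row M) \<and>
     M * P * M = M \<and> P * M * P = P \<and>
     transpose_mat (M * P) = M * P \<and> transpose_mat (P * M) = P * M"

definition pinv :: "real mat \<Rightarrow> real mat" where
  "pinv M = (THE P. is_pinv M P)"

text \<open>The library's \<open>orthogonal_mat\<close> only asks for pairwise orthogonal nonzero columns; it does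
  not normalise them.\<close>

definition orthonormal_cols :: "real mat \<Rightarrow> bool" where
  "orthonormal_cols Q \<longleftrightarrow> transpose_mat Q * Q = 1\<^sub>m (dim_col Q)"

definition is_full_svd :: "real mat \<Rightarrow> real mat \<Rightarrow> real mat \<Rightarrow> real mat \<Rightarrow> bool" where
  "is_full_svd M U \<Sigma> V \<longleftrightarrow>
     U \<in> carrier_mat (dim_row M) (dim_row M) \<and> orthonormal_cols U \<and>
     V \<in> carrier_mat (dim_col M) (dim_col M) \<and> orthonormal_cols V \<and>
     \<Sigma> \<in> carrier_mat (dim_row M) (dim_col M) \<and> diagonal_mat \<Sigma> \<and>
     (\<forall>i < min (dim_row M) (dim_col M). 0 \<le> \<Sigma> $$ (i,i)) \<and>
     (\<forall>i j. i \<le> j \<longrightarrow> j < min (dim_row M) (dim_col M) \<longrightarrow> \<Sigma> $$ (j,j) \<le> \<Sigma> $$ (i,i)) \<and>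
     M = U * \<Sigma> * transpose_mat V"

text \<open>Only meaningful for \<open>j < min (dim_row M) (dim_col M)\<close>; there the value does not depend on the
  chosen decomposition.\<close>

definition sing_val :: "real mat \<Rightarrow> nat \<Rightarrow> real" where
  "sing_val M j = (THE s. \<exists>U \<Sigma> V. is_full_svd M U \<Sigma> V \<and> s = \<Sigma> $$ (j,j))"

definition map_diag :: "(real \<Rightarrow> real) \<Rightarrow> real mat \<Rightarrow> real mat" where
  "map_diag f D = mat (dim_row D) (dim_col D) (\<lambda>(i,j). if i = j then f (D $$ (i,j)) else 0)"

definition krylov_mat :: "real mat \<Rightarrow> real mat \<Rightarrow> nat \<Rightarrow> real mat" where
  "krylov_mat A X q = mat_of_cols (dim_row A)
     (concat (map (\<lambda>j. cols ((A * transpose_mat A) ^\<^sub>m j * (A * X))) [0..<Suc q]))"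

definition is_orthonormal_basis :: "nat \<Rightarrow> real vec set \<Rightarrow> real mat \<Rightarrow> bool" where
  "is_orthonormal_basis m S Q \<longleftrightarrow> dim_row Q = m \<and> orthonormal_cols Q \<and> mat_range Q = S"

text \<open>Diagonal matrix of the principal angles between subspaces \<open>S\<close>, \<open>W\<close> of \<open>\<real>\<^sup>m\<close> with
  \<open>dim W \<le> dim S\<close>; the singular values do not depend on the bases chosen. As the singular values
  decrease, the angles increase along the diagonal.\<close>

definition principal_angles :: "nat \<Rightarrow> real vec set \<Rightarrow> real vec set \<Rightarrow> real mat" where
  "principal_angles m S W =
     (let Q = (SOME Q. is_orthonormal_basis m S Q);
          B = (SOME B. is_orthonormal_basis m W B)
      in mat_diag (dim_col B) (\<lambda>j. arccos (sing_val (transpose_mat B * Q) j)))"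

end

theory Submission
  imports Defs "Jordan_Normal_Form.Spectral_Radius"
begin

text \<open>Write \<open>G = V\<^sub>k\<^sup>T X\<close>, \<open>P\<close> for its pseudoinverse and \<open>T = V\<^sub>p\<^sup>T X P\<close>. As \<open>G\<close> has full row rank,
  \<open>G P = 1\<close>, so that \<open>V\<^sup>T X P y\<close> is \<open>y\<close> stacked on \<open>T y\<close>.

  An odd polynomial \<open>\<phi>\<close> of degree \<open>2q + 1\<close> makes \<open>U \<phi>(\<Sigma>) V\<^sup>T\<close> a linear combination of the
  matrices \<open>(A A\<^sup>T)\<^sup>j A\<close> with \<open>j \<le> q\<close>, so the Krylov space contains \<open>U \<phi>(\<Sigma>) V\<^sup>T X y\<close> for every \<open>y\<close>
  (\<open>odd_poly_mem_krylov\<close>). The choice \<open>y = P e\<^sub>i / \<phi>(\<sigma>\<^sub>i)\<close> gives a point of the Krylov space that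
  differs from \<open>u\<^sub>i\<close> by a vector of length
  \<open>\<parallel>\<phi>(\<Sigma>\<^sub>p) T e\<^sub>i\<parallel> / \<bar>\<phi>(\<sigma>\<^sub>i)\<bar> \<le> \<parallel>\<phi>(\<Sigma>\<^sub>p)\<parallel> \<parallel>T\<parallel> / \<bar>\<phi>(\<sigma>\<^sub>i)\<bar>\<close>. The sine of the angle is the distance from
  \<open>u\<^sub>i\<close> to the Krylov space (\<open>sin_angle_le_dist\<close>), which is the first bound.

  If the columns of \<open>X\<close> are orthonormal, \<open>\<parallel>T\<parallel>\<close> is at most the tangent of the largest angle
  between the ranges of \<open>X\<close> and \<open>V\<^sub>k\<close>. The cosine \<open>\<sigma>\<close> of that angle is the least value of
  \<open>\<parallel>X\<^sup>T V\<^sub>k w\<parallel> = \<parallel>G\<^sup>T w\<parallel>\<close> over unit vectors \<open>w\<close>, so \<open>\<parallel>P y\<parallel> \<le> \<parallel>y\<parallel> / \<sigma>\<close>; and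
  \<open>\<parallel>T y\<parallel>\<^sup>2 = \<parallel>P y\<parallel>\<^sup>2 - \<parallel>y\<parallel>\<^sup>2\<close> because \<open>V\<^sup>T X\<close> preserves lengths. Together,
  \<open>\<parallel>T y\<parallel>\<^sup>2 \<le> (1 / \<sigma>\<^sup>2 - 1) \<parallel>y\<parallel>\<^sup>2\<close>.

  Both halves read one angle off \<^const>\<open>principal_angles\<close>, the largest. It comes from the smallest
  singular value of a matrix \<open>M\<close> with no more rows than columns. That value is the minimum of
  \<open>\<parallel>M\<^sup>T x\<parallel>\<close> over unit vectors and thus unique (\<open>smallest_sing_val\<close>), while the description
  defining \<^const>\<open>sing_val\<close> also requires that a decomposition exists (\<open>ex_full_svd\<close>); this rests
  on the spectral theorem for real symmetric matrices (\<open>symmetric_mat_eigensystem\<close>).\<close>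

section \<open>Euclidean norm and spectral norm\<close>

lemma eq_vec_carrierI:
  assumes "v \<in> carrier_vec n" "w \<in> carrier_vec n" "\<And>i. i < n \<Longrightarrow> v $ i = w $ i"
  shows "v = w"
  using assms by (intro eq_vecI) auto

lemma scalar_prod_self_nonneg: "0 \<le> v \<bullet> (v :: real vec)"
  unfolding scalar_prod_def by (intro sum_nonneg) simp

lemma vec_norm2_nonneg [simp]: "0 \<le> vec_norm2 v"
  unfolding vec_norm2_def by (simp add: scalar_prod_self_nonneg)

lemma vec_norm2_sq: "(vec_norm2 v)\<^sup>2 = v \<bullet> v"
  unfolding vec_norm2_def by (simp add: scalar_prod_self_nonneg)

lemma vec_norm2_smult: "vec_norm2 (a \<cdot>\<^sub>v v) = \<bar>a\<bar> * vec_norm2 v"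
proof -
  have "(a \<cdot>\<^sub>v v) \<bullet> (a \<cdot>\<^sub>v v) = a\<^sup>2 * (v \<bullet> v)"
    by (simp add: power2_eq_square)
  then show ?thesis
    unfolding vec_norm2_def by (simp add: real_sqrt_mult)
qed

lemma scalar_prod_self_eq_0:
  fixes v :: "real vec"
  assumes "v \<in> carrier_vec n"
  shows "v \<bullet> v = 0 \<longleftrightarrow> v = 0\<^sub>v n"
proof
  assume "v \<bullet> v = 0"
  then have "\<forall>i\<in>{0..<dim_vec v}. v $ i * v $ i = 0"
    unfolding scalar_prod_def by (subst sum_nonneg_eq_0_iff[symmetric]) auto
  then show "v = 0\<^sub>v n"
    using assms by (intro eq_vecI) auto
qed (use assms in simp)

lemma vec_norm2_eq_0:
  assumes "v \<in> carrier_vec n"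
  shows "vec_norm2 v = 0 \<longleftrightarrow> v = 0\<^sub>v n"
  using scalar_prod_self_eq_0[OF assms] unfolding vec_norm2_def by simp

lemma normalized_scalar_prod_self:
  assumes "vec_norm2 v \<noteq> 0"
  shows "((1 / vec_norm2 v) \<cdot>\<^sub>v v) \<bullet> ((1 / vec_norm2 v) \<cdot>\<^sub>v v) = 1"
proof -
  have "vec_norm2 ((1 / vec_norm2 v) \<cdot>\<^sub>v v) = 1" using assms by (simp add: vec_norm2_smult)
  then show ?thesis by (metis vec_norm2_sq one_power2)
qed

lemma scalar_prod_minus_self:
  fixes v w :: "real vec"
  assumes "v \<in> carrier_vec n" "w \<in> carrier_vec n"
  shows "(v - w) \<bullet> (v - w) = v \<bullet> v - 2 * (v \<bullet> w) + w \<bullet> w"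
  using assms comm_scalar_prod[OF assms]
  by (simp add: minus_scalar_prod_distrib[of _ n] scalar_prod_minus_distrib[of _ n])

lemma Cauchy_Schwarz_vec:
  assumes v: "v \<in> carrier_vec n" and w: "w \<in> carrier_vec n"
  shows "\<bar>v \<bullet> w\<bar> \<le> vec_norm2 v * vec_norm2 w"
proof (cases "w = 0\<^sub>v n")
  case True
  then show ?thesis using v by simp
next
  case False
  define b where "b = w \<bullet> w"
  have b: "b > 0"
    using False scalar_prod_self_eq_0[OF w] scalar_prod_self_nonneg[of w] b_def by auto
  define a where "a = (v \<bullet> w) / b"
  \<comment> \<open>\<open>a w\<close> is the projection of \<open>v\<close> to the line of \<open>w\<close>.\<close>
  have "0 \<le> (v - a \<cdot>\<^sub>v w) \<bullet> (v - a \<cdot>\<^sub>v w)" by (rule scalar_prod_self_nonneg)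
  also have "\<dots> = v \<bullet> v - (v \<bullet> w)\<^sup>2 / b"
    using v w b
    by (simp add: scalar_prod_minus_self[of _ n] b_def[symmetric])
       (simp add: a_def power2_eq_square field_simps)
  finally have "(v \<bullet> w)\<^sup>2 \<le> (v \<bullet> v) * (w \<bullet> w)"
    using b by (simp add: b_def field_simps)
  then have "\<bar>v \<bullet> w\<bar>\<^sup>2 \<le> (vec_norm2 v * vec_norm2 w)\<^sup>2"
    by (simp add: power_mult_distrib vec_norm2_sq)
  then show ?thesis
    by (rule power2_le_imp_le) simp
qed

text \<open>A bound by the Frobenius norm. It makes the supremum in \<^const>\<open>spectral_norm\<close> one over a
  bounded set.\<close>

lemma vec_norm2_mult_le:
  assumes M: "M \<in> carrier_mat r c"
  shows "\<exists>K\<ge>0. \<forall>v\<in>carrier_vec c. vec_norm2 (M *\<^sub>v v) \<le> K * vec_norm2 v"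
proof -
  define K2 where "K2 = (\<Sum>i\<in>{0..<r}. row M i \<bullet> row M i)"
  have K2: "K2 \<ge> 0" unfolding K2_def by (intro sum_nonneg scalar_prod_self_nonneg)
  have "vec_norm2 (M *\<^sub>v v) \<le> sqrt K2 * vec_norm2 v" if v: "v \<in> carrier_vec c" for v
  proof -
    have "(row M i \<bullet> v)\<^sup>2 \<le> (row M i \<bullet> row M i) * (v \<bullet> v)" if "i < r" for i
    proof -
      have "\<bar>row M i \<bullet> v\<bar>\<^sup>2 \<le> (vec_norm2 (row M i) * vec_norm2 v)\<^sup>2"
        using Cauchy_Schwarz_vec[of "row M i" c v] M v that by (intro power_mono) auto
      then show ?thesis by (simp add: power_mult_distrib vec_norm2_sq)
    qed
    then have "(\<Sum>i\<in>{0..<r}. (row M i \<bullet> v)\<^sup>2) \<le> K2 * (v \<bullet> v)"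
      unfolding K2_def sum_distrib_right by (intro sum_mono) simp
    also have "(\<Sum>i\<in>{0..<r}. (row M i \<bullet> v)\<^sup>2) = (M *\<^sub>v v) \<bullet> (M *\<^sub>v v)"
      using M unfolding scalar_prod_def[of "M *\<^sub>v v" "M *\<^sub>v v"]
      by (simp add: power2_eq_square)
    finally have "(M *\<^sub>v v) \<bullet> (M *\<^sub>v v) \<le> K2 * (v \<bullet> v)" .
    then show ?thesis unfolding vec_norm2_def by (metis real_sqrt_le_iff real_sqrt_mult)
  qed
  then show ?thesis using K2 by (intro exI[of _ "sqrt K2"]) auto
qed

lemma spectral_norm_upper:
  assumes M: "M \<in> carrier_mat r c" and w: "w \<in> carrier_vec c" "vec_norm2 w \<le> 1"
  shows "vec_norm2 (M *\<^sub>v w) \<le> spectral_norm M"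
  unfolding spectral_norm_def
proof (rule cSUP_upper)
  obtain K where K: "K \<ge> 0" "\<And>v. v \<in> carrier_vec c \<Longrightarrow> vec_norm2 (M *\<^sub>v v) \<le> K * vec_norm2 v"
    using vec_norm2_mult_le[OF M] by auto
  show "bdd_above ((\<lambda>v. vec_norm2 (M *\<^sub>v v)) ` {v \<in> carrier_vec (dim_col M). vec_norm2 v \<le> 1})"
  proof (intro bdd_aboveI2[of _ _ K])
    fix x assume "x \<in> {v \<in> carrier_vec (dim_col M). vec_norm2 v \<le> 1}"
    then have "vec_norm2 (M *\<^sub>v x) \<le> K * vec_norm2 x" "vec_norm2 x \<le> 1" using K M by auto
    then show "vec_norm2 (M *\<^sub>v x) \<le> K" using K(1) mult_left_le by (meson order_trans)
  qed
qed (use M w in simp)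

lemma spectral_norm_bound:
  assumes M: "M \<in> carrier_mat r c" and v: "v \<in> carrier_vec c"
  shows "vec_norm2 (M *\<^sub>v v) \<le> spectral_norm M * vec_norm2 v"
proof (cases "v = 0\<^sub>v c")
  case True
  then have "M *\<^sub>v v = 0\<^sub>v r" using M by (intro eq_vecI) auto
  then have "vec_norm2 (M *\<^sub>v v) = 0" by (simp add: vec_norm2_def)
  moreover have "vec_norm2 v = 0" using True by (simp add: vec_norm2_def)
  ultimately show ?thesis by simp
next
  case False
  let ?a = "vec_norm2 v"
  have a: "?a > 0"
    using False vec_norm2_eq_0[OF v] vec_norm2_nonneg[of v] by linarith
  have "vec_norm2 (M *\<^sub>v ((1 / ?a) \<cdot>\<^sub>v v)) \<le> spectral_norm M"
    by (rule spectral_norm_upper[OF M]) (use v a in \<open>simp_all add: vec_norm2_smult\<close>)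
  then show ?thesis
    using a by (simp add: mult_mat_vec[OF M v] vec_norm2_smult field_simps)
qed

lemma spectral_norm_le:
  assumes M: "M \<in> carrier_mat r c" and C: "0 \<le> C"
    and le: "\<And>v. v \<in> carrier_vec c \<Longrightarrow> vec_norm2 (M *\<^sub>v v) \<le> C * vec_norm2 v"
  shows "spectral_norm M \<le> C"
  unfolding spectral_norm_def
proof (rule cSUP_least)
  have "0\<^sub>v c \<in> {v \<in> carrier_vec (dim_col M). vec_norm2 v \<le> 1}"
    using M by (simp add: vec_norm2_def)
  then show "{v \<in> carrier_vec (dim_col M). vec_norm2 v \<le> 1} \<noteq> {}" by blast
next
  fix v assume "v \<in> {v \<in> carrier_vec (dim_col M). vec_norm2 v \<le> 1}"
  then have "vec_norm2 (M *\<^sub>v v) \<le> C * vec_norm2 v" "vec_norm2 v \<le> 1" using le M by auto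
  then show "vec_norm2 (M *\<^sub>v v) \<le> C" using C mult_left_le by (meson order_trans)
qed

lemma spectral_norm_nonneg:
  assumes M: "M \<in> carrier_mat r c"
  shows "0 \<le> spectral_norm M"
  by (rule order_trans[OF vec_norm2_nonneg spectral_norm_upper[OF M, of "0\<^sub>v c"]])
    (simp_all add: vec_norm2_def)

lemma abs_diag_entry_le_spectral_norm:
  assumes M: "M \<in> carrier_mat r r" and j: "j < r"
  shows "\<bar>M $$ (j, j)\<bar> \<le> spectral_norm M"
proof -
  have e: "unit_vec r j \<in> carrier_vec r" by simp
  have ne: "vec_norm2 (unit_vec r j) = 1" using j by (simp add: vec_norm2_def)
  have "unit_vec r j \<bullet> (M *\<^sub>v unit_vec r j) = M $$ (j, j)"
    using M j by (simp add: scalar_prod_left_unit[of _ r])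
  then have "\<bar>M $$ (j, j)\<bar> \<le> vec_norm2 (M *\<^sub>v unit_vec r j)"
    using Cauchy_Schwarz_vec[OF e, of "M *\<^sub>v unit_vec r j"] M ne by simp
  also have "\<dots> \<le> spectral_norm M"
    using spectral_norm_bound[OF M e] ne by simp
  finally show ?thesis .
qed

section \<open>Matrices with orthonormal columns\<close>

lemma orthonormal_cols_iff:
  assumes "Q \<in> carrier_mat n l"
  shows "orthonormal_cols Q \<longleftrightarrow>
    (\<forall>i<l. \<forall>j<l. col Q i \<bullet> col Q j = (if i = j then 1 else 0))"
  using assms unfolding orthonormal_cols_def mat_eq_iff by auto

lemma adjoint_mult_vec:
  fixes M :: "real mat"
  assumes "M \<in> carrier_mat r c" "x \<in> carrier_vec c" "y \<in> carrier_vec r"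
  shows "(M *\<^sub>v x) \<bullet> y = x \<bullet> (M\<^sup>T *\<^sub>v y)"
proof -
  have "(M *\<^sub>v x) \<bullet> y = y \<bullet> (M *\<^sub>v x)" using assms by (intro comm_scalar_prod[of _ r]) auto
  also have "\<dots> = (M\<^sup>T *\<^sub>v y) \<bullet> x" using transpose_vec_mult_scalar[OF assms] by simp
  also have "\<dots> = x \<bullet> (M\<^sup>T *\<^sub>v y)" using assms by (intro comm_scalar_prod[of _ c]) auto
  finally show ?thesis .
qed

lemma orthonormal_cols_transpose_mult:
  assumes Q: "Q \<in> carrier_mat n l" and o: "orthonormal_cols Q" and x: "x \<in> carrier_vec l"
  shows "Q\<^sup>T *\<^sub>v (Q *\<^sub>v x) = x"
proof -
  have "Q\<^sup>T *\<^sub>v (Q *\<^sub>v x) = (Q\<^sup>T * Q) *\<^sub>v x"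
    using Q x by (subst assoc_mult_mat_vec[of _ l n _ l]) auto
  then show ?thesis using o Q x unfolding orthonormal_cols_def by simp
qed

lemma orthonormal_cols_isometry:
  assumes Q: "Q \<in> carrier_mat n l" and o: "orthonormal_cols Q" and x: "x \<in> carrier_vec l"
  shows "vec_norm2 (Q *\<^sub>v x) = vec_norm2 x"
  unfolding vec_norm2_def
  using adjoint_mult_vec[OF Q x, of "Q *\<^sub>v x"] orthonormal_cols_transpose_mult[OF Q o x] Q x by simp

lemma square_orthonormal_cols:
  assumes Q: "Q \<in> carrier_mat n n" and o: "orthonormal_cols Q"
  shows "Q * Q\<^sup>T = 1\<^sub>m n" and "orthonormal_cols (Q\<^sup>T)"
proof -
  have "Q\<^sup>T * Q = 1\<^sub>m n" using o Q unfolding orthonormal_cols_def by simp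
  then show 1: "Q * Q\<^sup>T = 1\<^sub>m n"
    using mat_mult_left_right_inverse[of "Q\<^sup>T" n Q] Q by simp
  then show "orthonormal_cols (Q\<^sup>T)" using Q unfolding orthonormal_cols_def by simp
qed

lemma mat_range_eq: "mat_range M = {M *\<^sub>v x | x. x \<in> carrier_vec (dim_col M)}"
proof -
  interpret vec_space "TYPE(real)" "dim_row M" .
  have "M *\<^sub>v x \<in> carrier_vec (dim_row M)" for x by (intro carrier_vecI) simp
  then show ?thesis unfolding col_space_eq[OF carrier_matI[OF refl refl]] by blast
qed

lemma mat_range_memI: "M \<in> carrier_mat r c \<Longrightarrow> x \<in> carrier_vec c \<Longrightarrow> M *\<^sub>v x \<in> mat_range M"
  unfolding mat_range_eq by auto

lemma mat_range_smult:
  assumes N: "N \<in> carrier_mat n c" and z: "z \<in> mat_range N"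
  shows "a \<cdot>\<^sub>v z \<in> mat_range N"
proof -
  obtain x where x: "x \<in> carrier_vec c" "z = N *\<^sub>v x"
    using z N unfolding mat_range_eq by auto
  then have "a \<cdot>\<^sub>v z = N *\<^sub>v (a \<cdot>\<^sub>v x)" using N by (simp add: mult_mat_vec)
  then show ?thesis using mat_range_memI[OF N, of "a \<cdot>\<^sub>v x"] x by simp
qed

lemma mat_range_add:
  assumes N: "N \<in> carrier_mat n c" and y: "y \<in> mat_range N" and z: "z \<in> mat_range N"
  shows "y + z \<in> mat_range N"
proof -
  obtain x x' where x: "x \<in> carrier_vec c" "y = N *\<^sub>v x" "x' \<in> carrier_vec c" "z = N *\<^sub>v x'"
    using y z N unfolding mat_range_eq by auto
  then have "y + z = N *\<^sub>v (x + x')" using N by (simp add: mult_add_distrib_mat_vec)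
  then show ?thesis using mat_range_memI[OF N, of "x + x'"] x by simp
qed

lemma col_eq_mult_unit_vec:
  fixes M :: "real mat"
  assumes "M \<in> carrier_mat r c" "j < c"
  shows "M *\<^sub>v unit_vec c j = col M j"
  using assms by (intro eq_vecI) (auto simp: scalar_prod_right_unit[of _ c])

lemma mat_range_subsetI:
  assumes M: "M \<in> carrier_mat n d" and N: "N \<in> carrier_mat n c"
    and cols: "\<And>j. j < d \<Longrightarrow> col M j \<in> mat_range N"
  shows "mat_range M \<subseteq> mat_range N"
proof -
  interpret vec_space "TYPE(real)" n .
  have dims: "dim_row M = n" "dim_row N = n" using M N by auto
  have "set (cols M) \<subseteq> span (set (cols N))"
    using cols M unfolding dims cols_def col_space_def by auto
  then show ?thesis
    using N unfolding dims col_space_def by (intro span_subsetI) (auto simp: cols_def)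
qed

text \<open>Pythagoras: \<open>Q Q\<^sup>T w\<close> is the orthogonal projection of \<open>w\<close> to the range of \<open>Q\<close>, and every
  other point of the range is farther from \<open>w\<close>.\<close>

lemma dist_to_range_ge:
  assumes Q: "Q \<in> carrier_mat n l" and o: "orthonormal_cols Q"
    and w: "w \<in> carrier_vec n" and z: "z \<in> mat_range Q"
  shows "w \<bullet> w - (Q\<^sup>T *\<^sub>v w) \<bullet> (Q\<^sup>T *\<^sub>v w) \<le> (w - z) \<bullet> (w - z)"
proof -
  obtain x where x: "x \<in> carrier_vec l" and zx: "z = Q *\<^sub>v x"
    using z Q unfolding mat_range_eq by auto
  have zz: "z \<bullet> z = x \<bullet> x"
    using orthonormal_cols_isometry[OF Q o x] vec_norm2_sq zx by metis
  have wz: "w \<bullet> z = (Q\<^sup>T *\<^sub>v w) \<bullet> x"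
    using transpose_vec_mult_scalar[OF Q x w] zx by simp
  have "0 \<le> (Q\<^sup>T *\<^sub>v w - x) \<bullet> (Q\<^sup>T *\<^sub>v w - x)" by (rule scalar_prod_self_nonneg)
  also have "\<dots> = (Q\<^sup>T *\<^sub>v w) \<bullet> (Q\<^sup>T *\<^sub>v w) - 2 * (w \<bullet> z) + z \<bullet> z"
    using Q w x by (subst scalar_prod_minus_self[of _ l]) (auto simp: wz zz)
  finally show ?thesis
    using scalar_prod_minus_self[of w n z] w zx Q x by simp
qed

lemma dist_to_projection:
  assumes Q: "Q \<in> carrier_mat n l" and o: "orthonormal_cols Q" and w: "w \<in> carrier_vec n"
  defines "p \<equiv> Q *\<^sub>v (Q\<^sup>T *\<^sub>v w)"
  shows "(w - p) \<bullet> (w - p) = w \<bullet> w - (Q\<^sup>T *\<^sub>v w) \<bullet> (Q\<^sup>T *\<^sub>v w)"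
proof -
  let ?x = "Q\<^sup>T *\<^sub>v w"
  have x: "?x \<in> carrier_vec l" using Q w by simp
  have pp: "p \<bullet> p = ?x \<bullet> ?x"
    using orthonormal_cols_isometry[OF Q o x] vec_norm2_sq p_def by metis
  have wp: "w \<bullet> p = ?x \<bullet> ?x"
    using transpose_vec_mult_scalar[OF Q x w] p_def by simp
  show ?thesis
    using scalar_prod_minus_self[of w n p] w pp wp p_def Q x by simp
qed

lemma projection_norm_le:
  assumes "Q \<in> carrier_mat n l" "orthonormal_cols Q" "w \<in> carrier_vec n"
  shows "vec_norm2 (Q\<^sup>T *\<^sub>v w) \<le> vec_norm2 w"
  using dist_to_projection[OF assms] scalar_prod_self_nonneg[of "w - Q *\<^sub>v (Q\<^sup>T *\<^sub>v w)"]
  unfolding vec_norm2_def by simp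

text \<open>The length of the projection of \<open>w\<close> to a subspace does not depend on the orthonormal basis
  used to compute it, because the distance to the subspace does not.\<close>

lemma projection_norm_cong:
  assumes Q: "Q \<in> carrier_mat n a" "orthonormal_cols Q"
    and R: "R \<in> carrier_mat n b" "orthonormal_cols R"
    and eq: "mat_range Q = mat_range R" and w: "w \<in> carrier_vec n"
  shows "vec_norm2 (Q\<^sup>T *\<^sub>v w) = vec_norm2 (R\<^sup>T *\<^sub>v w)"
proof -
  have "Q *\<^sub>v (Q\<^sup>T *\<^sub>v w) \<in> mat_range R" "R *\<^sub>v (R\<^sup>T *\<^sub>v w) \<in> mat_range Q"
    using mat_range_memI[OF Q(1), of "Q\<^sup>T *\<^sub>v w"] mat_range_memI[OF R(1), of "R\<^sup>T *\<^sub>v w"] Q R w eq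
    by auto
  then have "(Q\<^sup>T *\<^sub>v w) \<bullet> (Q\<^sup>T *\<^sub>v w) = (R\<^sup>T *\<^sub>v w) \<bullet> (R\<^sup>T *\<^sub>v w)"
    using dist_to_range_ge[OF R w] dist_to_range_ge[OF Q w]
      dist_to_projection[OF R w] dist_to_projection[OF Q w] by (intro antisym) fastforce+
  then show ?thesis by (simp add: vec_norm2_def)
qed

section \<open>Orthonormal systems and their completion\<close>

text \<open>Systems are given as functions of the index, so that appending a vector is a function update
  and reordering is composition with a permutation.\<close>

definition orthonormal_system :: "nat \<Rightarrow> nat \<Rightarrow> (nat \<Rightarrow> real vec) \<Rightarrow> bool" where
  "orthonormal_system n l u \<longleftrightarrow>
     (\<forall>i<l. u i \<in> carrier_vec n) \<and> (\<forall>i<l. \<forall>j<l. u i \<bullet> u j = (if i = j then 1 else 0))"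

abbreviation system_mat :: "nat \<Rightarrow> nat \<Rightarrow> (nat \<Rightarrow> real vec) \<Rightarrow> real mat" where
  "system_mat n l u \<equiv> mat_of_cols n (map u [0..<l])"

lemma system_mat_carrier [simp]: "system_mat n l u \<in> carrier_mat n l"
  by (simp add: carrier_matI)

lemma col_system_mat:
  assumes "orthonormal_system n l u" "i < l"
  shows "col (system_mat n l u) i = u i"
  using assms unfolding orthonormal_system_def by (simp add: col_mat_of_cols)

lemma orthonormal_cols_system_mat:
  assumes "orthonormal_system n l u"
  shows "orthonormal_cols (system_mat n l u)"
  using assms by (subst orthonormal_cols_iff[of _ n l])
    (auto simp: col_system_mat[OF assms] orthonormal_system_def)

lemma system_mat_transpose_index:
  assumes "orthonormal_system n l u" "i < l"
  shows "((system_mat n l u)\<^sup>T *\<^sub>v x) $ i = u i \<bullet> x"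
  using assms col_system_mat[OF assms] by simp

text \<open>Fewer than \<open>n\<close> homogeneous equations in \<open>n\<close> unknowns have a nonzero solution: padded with
  zero rows, the system has determinant zero.\<close>

lemma ex_unit_vec_orthogonal:
  assumes u: "\<forall>i<l. u i \<in> carrier_vec n" and l: "l < n"
  shows "\<exists>v\<in>carrier_vec n. v \<bullet> v = 1 \<and> (\<forall>i<l. u i \<bullet> v = (0 :: real))"
proof -
  define M where "M = mat n n (\<lambda>(i, j). if i < l then u i $ j else 0)"
  have M: "M \<in> carrier_mat n n" unfolding M_def by simp
  have row: "row M i = u i" if "i < l" for i
    using that l u unfolding M_def by (intro eq_vecI) auto
  have "det M = 0"
  proof (rule ccontr)
    assume "det M \<noteq> 0"
    then obtain B where B: "B \<in> carrier_mat n n" "M * B = 1\<^sub>m n"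
      using det_non_zero_imp_unit[OF M] unfolding Units_def ring_mat_def by auto
    have "row M l = 0\<^sub>v n" using l unfolding M_def by (intro eq_vecI) auto
    then have "(M * B) $$ (l, l) = 0" using l M B(1) by simp
    moreover have "(M * B) $$ (l, l) = 1" using B(2) l by simp
    ultimately show False by simp
  qed
  then obtain v where v: "v \<in> carrier_vec n" "v \<noteq> 0\<^sub>v n" "M *\<^sub>v v = 0\<^sub>v n"
    using det_0_iff_vec_prod_zero[OF M] by auto
  have ortho: "u i \<bullet> v = 0" if "i < l" for i
    using row[OF that] v(3) that l M by (metis carrier_matD(1) index_mult_mat_vec index_zero_vec(1) less_trans)
  let ?w = "(1 / vec_norm2 v) \<cdot>\<^sub>v v"
  have "vec_norm2 v \<noteq> 0" using v vec_norm2_eq_0 by blast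
  then have "?w \<bullet> ?w = 1" by (rule normalized_scalar_prod_self)
  moreover have "u i \<bullet> ?w = 0" if "i < l" for i
    using ortho[OF that] u that v by (subst scalar_prod_smult_distrib[of _ n]) auto
  ultimately show ?thesis using v by (intro bexI[of _ ?w]) auto
qed

lemma orthonormal_system_Suc:
  assumes "orthonormal_system n l u" "v \<in> carrier_vec n" "v \<bullet> v = 1" "\<forall>i<l. u i \<bullet> v = 0"
  shows "orthonormal_system n (Suc l) (u(l := v))"
proof -
  have "v \<bullet> u i = 0" if "i < l" for i
    using assms that comm_scalar_prod[of v n "u i"] unfolding orthonormal_system_def by auto
  then show ?thesis using assms unfolding orthonormal_system_def by (auto simp: less_Suc_eq)
qed

lemma orthonormal_system_extend:
  assumes "orthonormal_system n l u" "l \<le> n"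
  shows "\<exists>u'. orthonormal_system n n u' \<and> (\<forall>i<l. u' i = u i)"
  using assms
proof (induction "n - l" arbitrary: l u)
  case 0
  then show ?case by (intro exI[of _ u]) auto
next
  case (Suc d)
  then have l: "l < n" by auto
  obtain v where v: "v \<in> carrier_vec n" "v \<bullet> v = 1" "\<forall>i<l. u i \<bullet> v = 0"
    using ex_unit_vec_orthogonal[of l u n] l Suc.prems unfolding orthonormal_system_def by auto
  have "orthonormal_system n (Suc l) (u(l := v))"
    by (rule orthonormal_system_Suc[OF Suc.prems(1) v])
  moreover have "d = n - Suc l" "Suc l \<le> n" using Suc.hyps(2) l by auto
  ultimately obtain u' where
    "orthonormal_system n n u'" "\<forall>i<Suc l. u' i = (u(l := v)) i"
    using Suc.hyps(1)[of "Suc l" "u(l := v)"] by blast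
  then show ?case by (intro exI[of _ u']) auto
qed

text \<open>A vector is determined by its coordinates in an orthonormal basis, since \<open>Q Q\<^sup>T = 1\<close> for square
  \<open>Q\<close>.\<close>

lemma orthonormal_basis_eqI:
  assumes u: "orthonormal_system n n u" and v: "v \<in> carrier_vec n" and w: "w \<in> carrier_vec n"
    and eq: "\<And>i. i < n \<Longrightarrow> u i \<bullet> v = u i \<bullet> w"
  shows "v = w"
proof -
  let ?Q = "system_mat n n u"
  have eqT: "?Q\<^sup>T *\<^sub>v v = ?Q\<^sup>T *\<^sub>v w"
    using eq by (intro eq_vecI) (simp_all add: system_mat_transpose_index[OF u] del: index_mult_mat_vec)
  have "?Q *\<^sub>v (?Q\<^sup>T *\<^sub>v x) = x" if "x \<in> carrier_vec n" for x
    using square_orthonormal_cols(1)[OF system_mat_carrier orthonormal_cols_system_mat[OF u]] that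
    by (subst assoc_mult_mat_vec[symmetric, of _ n n _ n]) auto
  then show ?thesis using v w eqT by metis
qed

text \<open>The first \<open>n\<close> vectors already form a basis, so that a further one, orthogonal to all of them,
  would be zero.\<close>

lemma orthonormal_system_le:
  assumes u: "orthonormal_system n l u"
  shows "l \<le> n"
proof (rule ccontr)
  assume "\<not> l \<le> n"
  then have l: "n < l" by simp
  then have "orthonormal_system n n u" using u unfolding orthonormal_system_def by auto
  then have "u n = 0\<^sub>v n"
    using l u unfolding orthonormal_system_def
    by (intro orthonormal_basis_eqI[of n u]) (auto simp: orthonormal_system_def)
  moreover have "u n \<bullet> u n = 1" using u l unfolding orthonormal_system_def by auto
  ultimately show False by simp
qed

lemma orthonormal_cols_le_of_range_subset:
  assumes Q: "Q \<in> carrier_mat n a" "orthonormal_cols Q"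
    and R: "R \<in> carrier_mat n b" "orthonormal_cols R"
    and sub: "mat_range Q \<subseteq> mat_range R"
  shows "a \<le> b"
proof -
  \<comment> \<open>\<open>R\<^sup>T\<close> is isometric on the range of \<open>R\<close>, so it carries the columns of \<open>Q\<close> to an orthonormal
    system in dimension \<open>b\<close>.\<close>
  have "orthonormal_system b a (\<lambda>j. R\<^sup>T *\<^sub>v col Q j)"
    unfolding orthonormal_system_def
  proof safe
    show "R\<^sup>T *\<^sub>v col Q i \<in> carrier_vec b" if "i < a" for i using R Q that by simp
  next
    fix i j assume ij: "i < a" "j < a"
    have "col Q j \<in> mat_range R"
      using sub mat_range_memI[OF Q(1), of "unit_vec a j"] col_eq_mult_unit_vec[OF Q(1)] ij by auto
    then obtain x where x: "x \<in> carrier_vec b" "col Q j = R *\<^sub>v x"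
      using R unfolding mat_range_eq by auto
    have "(R\<^sup>T *\<^sub>v col Q i) \<bullet> (R\<^sup>T *\<^sub>v col Q j) = (R\<^sup>T *\<^sub>v col Q i) \<bullet> x"
      using x orthonormal_cols_transpose_mult[OF R x(1)] by simp
    also have "\<dots> = col Q i \<bullet> col Q j"
      using transpose_vec_mult_scalar[OF R(1) x(1), of "col Q i"] x Q ij by simp
    also have "\<dots> = (if i = j then 1 else 0)"
      using Q orthonormal_cols_iff[OF Q(1)] ij by simp
    finally show "(R\<^sup>T *\<^sub>v col Q i) \<bullet> (R\<^sup>T *\<^sub>v col Q j) = (if i = j then 1 else 0)" .
  qed
  then show ?thesis by (rule orthonormal_system_le)
qed

lemma orthonormal_cols_eq_of_range_eq:
  assumes "Q \<in> carrier_mat n a" "orthonormal_cols Q" "R \<in> carrier_mat n b" "orthonormal_cols R"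
    "mat_range Q = mat_range R"
  shows "a = b"
  using orthonormal_cols_le_of_range_subset[OF assms(1-4)]
    orthonormal_cols_le_of_range_subset[OF assms(3,4,1,2)] assms(5) by simp

text \<open>An orthonormal system of greatest length inside the range spans it: the component of a
  remaining vector orthogonal to the system could be normalised and appended.\<close>

lemma ex_orthonormal_basis_of_range:
  assumes N: "N \<in> carrier_mat n c"
  shows "\<exists>l. \<exists>Q \<in> carrier_mat n l. orthonormal_cols Q \<and> mat_range Q = mat_range N"
proof -
  let ?P = "\<lambda>l. \<exists>u. orthonormal_system n l u \<and> (\<forall>i<l. u i \<in> mat_range N)"
  have P0: "?P 0" unfolding orthonormal_system_def by simp
  define l where "l = (GREATEST l. ?P l)"
  have "?P l" unfolding l_def
    by (rule GreatestI_nat[of ?P, OF P0, of n]) (auto dest: orthonormal_system_le)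
  then obtain u where u: "orthonormal_system n l u" "\<forall>i<l. u i \<in> mat_range N" by auto
  have not_Suc: "\<not> ?P (Suc l)"
  proof
    assume "?P (Suc l)"
    then have "Suc l \<le> l" unfolding l_def
      by (rule Greatest_le_nat[of ?P _ n]) (auto dest: orthonormal_system_le)
    then show False by simp
  qed
  let ?Q = "system_mat n l u"
  have Q: "?Q \<in> carrier_mat n l" "orthonormal_cols ?Q"
    using orthonormal_cols_system_mat[OF u(1)] by auto
  have sub: "mat_range ?Q \<subseteq> mat_range N"
    by (rule mat_range_subsetI[OF Q(1) N]) (use u col_system_mat[OF u(1)] in auto)
  have "z \<in> mat_range ?Q" if z: "z \<in> mat_range N" for z
  proof (rule ccontr)
    assume nz: "z \<notin> mat_range ?Q"
    have zc: "z \<in> carrier_vec n" using z N unfolding mat_range_eq by auto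
    define p where "p = ?Q *\<^sub>v (?Q\<^sup>T *\<^sub>v z)"
    define r where "r = z + (-1) \<cdot>\<^sub>v p"
    have tz: "?Q\<^sup>T *\<^sub>v z \<in> carrier_vec l"
      by (rule mult_mat_vec_carrier[of _ l n]) (use zc in auto)
    have pQ: "p \<in> mat_range ?Q" unfolding p_def by (rule mat_range_memI[OF Q(1) tz])
    have pc: "p \<in> carrier_vec n" unfolding p_def
      by (rule mult_mat_vec_carrier[OF Q(1) tz])
    have rN: "r \<in> mat_range N" unfolding r_def using z pQ sub by (intro mat_range_add[OF N] mat_range_smult[OF N]) auto
    have rc: "r \<in> carrier_vec n" unfolding r_def using zc pc by simp
    have "r \<noteq> 0\<^sub>v n"
    proof
      assume "r = 0\<^sub>v n"
      have "z $ i = p $ i" if i: "i < n" for i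
      proof -
        have "r $ i = 0" using \<open>r = 0\<^sub>v n\<close> i by simp
        then show ?thesis unfolding r_def using zc pc i by simp
      qed
      then have "z = p" using zc pc by (intro eq_vecI) auto
      then show False using nz pQ by simp
    qed
    then have r0: "vec_norm2 r \<noteq> 0" using vec_norm2_eq_0[OF rc] by simp
    define v where "v = (1 / vec_norm2 r) \<cdot>\<^sub>v r"
    have vc: "v \<in> carrier_vec n" unfolding v_def using rc by simp
    have "v \<bullet> v = 1"
      unfolding v_def by (rule normalized_scalar_prod_self[OF r0])
    moreover have "u i \<bullet> v = 0" if "i < l" for i
    proof -
      have ui: "u i \<in> carrier_vec n" using u(1) that unfolding orthonormal_system_def by simp
      have "u i \<bullet> p = (?Q\<^sup>T *\<^sub>v p) $ i" using system_mat_transpose_index[OF u(1) that] by simp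
      also have "?Q\<^sup>T *\<^sub>v p = ?Q\<^sup>T *\<^sub>v z"
        unfolding p_def by (rule orthonormal_cols_transpose_mult[OF Q tz])
      also have "\<dots> $ i = u i \<bullet> z" using system_mat_transpose_index[OF u(1) that] by simp
      finally have "u i \<bullet> r = 0"
        unfolding r_def using ui zc pc by (simp add: scalar_prod_add_distrib[of _ n])
      then show ?thesis using ui rc unfolding v_def by simp
    qed
    ultimately have "orthonormal_system n (Suc l) (u(l := v))"
      using orthonormal_system_Suc[OF u(1) vc] by simp
    moreover have "v \<in> mat_range N" unfolding v_def by (rule mat_range_smult[OF N rN])
    ultimately have "?P (Suc l)" using u(2) by (intro exI[of _ "u(l := v)"]) auto
    then show False using not_Suc by simp
  qed
  then show ?thesis using sub Q by blast
qed

section \<open>Existence of singular value decompositions\<close>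

text \<open>Over \<open>\<complex>\<close> an eigenvector \<open>x + iy\<close> with eigenvalue \<open>a + ib\<close> exists. Symmetry gives
  \<open>b (x \<bullet> x + y \<bullet> y) = 0\<close>, so that \<open>b = 0\<close> and \<open>x\<close>, \<open>y\<close> are real eigenvectors or zero, and not
  both zero.\<close>

lemma symmetric_mat_ex_eigenvector:
  fixes S :: "real mat"
  assumes S: "S \<in> carrier_mat n n" and n: "0 < n" and sym: "S\<^sup>T = S"
  shows "\<exists>v\<in>carrier_vec n. \<exists>\<mu>. v \<noteq> 0\<^sub>v n \<and> S *\<^sub>v v = \<mu> \<cdot>\<^sub>v v"
proof -
  let ?C = "map_mat complex_of_real S"
  have C: "?C \<in> carrier_mat n n" using S by simp
  obtain \<mu> z where z: "z \<in> carrier_vec n" "z \<noteq> 0\<^sub>v n" "?C *\<^sub>v z = \<mu> \<cdot>\<^sub>v z"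
    using spectrum_non_empty[OF C n] S
    unfolding spectrum_def eigenvalue_def eigenvector_def by auto
  define x where "x = map_vec Re z"
  define y where "y = map_vec Im z"
  have x: "x \<in> carrier_vec n" and y: "y \<in> carrier_vec n" using z unfolding x_def y_def by auto
  have entry: "(\<Sum>j\<in>{0..<n}. complex_of_real (S $$ (i, j)) * z $ j) = \<mu> * z $ i" if "i < n" for i
  proof -
    have "(?C *\<^sub>v z) $ i = (\<Sum>j\<in>{0..<n}. complex_of_real (S $$ (i, j)) * z $ j)"
      using S z(1) that by (auto simp: scalar_prod_def intro!: sum.cong)
    then show ?thesis using z(1,3) that by simp
  qed
  have Sx: "(S *\<^sub>v x) $ i = Re \<mu> * x $ i - Im \<mu> * y $ i" if "i < n" for i
  proof -
    have "(S *\<^sub>v x) $ i = Re (\<Sum>j\<in>{0..<n}. complex_of_real (S $$ (i, j)) * z $ j)"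
      using S z(1) that unfolding x_def by (auto simp: scalar_prod_def intro!: sum.cong)
    then show ?thesis using entry[OF that] z(1) that unfolding x_def y_def by simp
  qed
  have Sy: "(S *\<^sub>v y) $ i = Re \<mu> * y $ i + Im \<mu> * x $ i" if "i < n" for i
  proof -
    have "(S *\<^sub>v y) $ i = Im (\<Sum>j\<in>{0..<n}. complex_of_real (S $$ (i, j)) * z $ j)"
      using S z(1) that unfolding y_def by (auto simp: scalar_prod_def intro!: sum.cong)
    then show ?thesis using entry[OF that] z(1) that unfolding x_def y_def by simp
  qed
  have Sx': "S *\<^sub>v x = Re \<mu> \<cdot>\<^sub>v x - Im \<mu> \<cdot>\<^sub>v y"
    using S x y Sx by (intro eq_vecI) (auto simp del: index_mult_mat_vec)
  have Sy': "S *\<^sub>v y = Re \<mu> \<cdot>\<^sub>v y + Im \<mu> \<cdot>\<^sub>v x"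
    using S x y Sy by (intro eq_vecI) (auto simp del: index_mult_mat_vec)
  have pos: "x \<bullet> x + y \<bullet> y > 0"
  proof (rule ccontr)
    assume "\<not> ?thesis"
    then have "x \<bullet> x = 0" "y \<bullet> y = 0"
      using scalar_prod_self_nonneg[of x] scalar_prod_self_nonneg[of y] by auto
    then have x0: "x = 0\<^sub>v n" and y0: "y = 0\<^sub>v n" using scalar_prod_self_eq_0 x y by blast+
    have "z $ i = 0" if "i < n" for i
    proof -
      have "x $ i = 0" "y $ i = 0" using x0 y0 that by auto
      then show ?thesis using z(1) that unfolding x_def y_def by (simp add: complex_eq_iff)
    qed
    then have "z = 0\<^sub>v n" using z(1) by (intro eq_vecI) auto
    then show False using z(2) by simp
  qed
  have "(S *\<^sub>v x) \<bullet> y = x \<bullet> (S *\<^sub>v y)" using adjoint_mult_vec[OF S x y] sym by simp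
  moreover have "(S *\<^sub>v x) \<bullet> y = Re \<mu> * (x \<bullet> y) - Im \<mu> * (y \<bullet> y)"
    unfolding Sx' using x y by (simp add: minus_scalar_prod_distrib[of _ n])
  moreover have "x \<bullet> (S *\<^sub>v y) = Re \<mu> * (x \<bullet> y) + Im \<mu> * (x \<bullet> x)"
    unfolding Sy' using x y by (simp add: scalar_prod_add_distrib[of _ n])
  ultimately have "Im \<mu> * (x \<bullet> x + y \<bullet> y) = 0" by (simp add: algebra_simps)
  then have Im0: "Im \<mu> = 0" using pos by simp
  have "S *\<^sub>v x = Re \<mu> \<cdot>\<^sub>v x" "S *\<^sub>v y = Re \<mu> \<cdot>\<^sub>v y"
    using S x y Sx Sy Im0 by (auto intro!: eq_vecI simp del: index_mult_mat_vec)
  moreover have "x \<noteq> 0\<^sub>v n \<or> y \<noteq> 0\<^sub>v n" using pos by auto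
  ultimately show ?thesis using x y by blast
qed

text \<open>An orthonormal system of \<open>l < n\<close> eigenvectors grows by one: the orthogonal complement is
  invariant, and an eigenvector of the compression of \<open>S\<close> to it is an eigenvector of \<open>S\<close>.\<close>

lemma symmetric_mat_eigensystem:
  fixes S :: "real mat"
  assumes S: "S \<in> carrier_mat n n" and sym: "S\<^sup>T = S" and "l \<le> n"
  shows "\<exists>u ev. orthonormal_system n l u \<and> (\<forall>i<l. S *\<^sub>v u i = ev i \<cdot>\<^sub>v u i)"
  using \<open>l \<le> n\<close>
proof (induction l)
  case 0
  then show ?case by (auto simp: orthonormal_system_def)
next
  case (Suc l)
  then obtain u0 ev where u0: "orthonormal_system n l u0" "\<forall>i<l. S *\<^sub>v u0 i = ev i \<cdot>\<^sub>v u0 i" by auto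
  then obtain u where u: "orthonormal_system n n u" and uu0: "\<forall>i<l. u i = u0 i"
    using orthonormal_system_extend[OF u0(1)] Suc.prems by auto
  have uc: "u i \<in> carrier_vec n" if "i < n" for i
    using u that unfolding orthonormal_system_def by auto
  define d where "d = n - l"
  have d: "0 < d" "l + d = n" using Suc.prems unfolding d_def by auto
  define W where "W = system_mat n d (\<lambda>i. u (l + i))"
  have sysW: "orthonormal_system n d (\<lambda>i. u (l + i))"
    using u d unfolding orthonormal_system_def by auto
  have W: "W \<in> carrier_mat n d" unfolding W_def by simp
  have WT: "(W\<^sup>T *\<^sub>v x) $ i = u (l + i) \<bullet> x" if "i < d" for i x
    unfolding W_def by (rule system_mat_transpose_index[OF sysW that])
  have WTW: "W\<^sup>T *\<^sub>v (W *\<^sub>v x) = x" if "x \<in> carrier_vec d" for x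
    unfolding W_def
    by (rule orthonormal_cols_transpose_mult[OF system_mat_carrier orthonormal_cols_system_mat[OF sysW] that])
  \<comment> \<open>the compression of \<open>S\<close> to the orthogonal complement, in the basis \<open>W\<close>\<close>
  let ?S = "W\<^sup>T * (S * W)"
  have "?S\<^sup>T = ?S"
    using S W sym by (simp add: transpose_mult[of _ d n _ d] transpose_mult[of _ n n _ d])
  moreover have "?S \<in> carrier_mat d d" using S W by simp
  ultimately obtain y \<mu> where y: "y \<in> carrier_vec d" "y \<noteq> 0\<^sub>v d" "?S *\<^sub>v y = \<mu> \<cdot>\<^sub>v y"
    using symmetric_mat_ex_eigenvector[of ?S d] d(1) by auto
  define w where "w = W *\<^sub>v y"
  have w: "w \<in> carrier_vec n" unfolding w_def using W y by simp
  have ulw: "u i \<bullet> w = 0" if "i < l" for i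
  proof -
    have i: "i < n" using that d by simp
    have "W\<^sup>T *\<^sub>v u i = 0\<^sub>v d"
      using W u that d i by (intro eq_vecI) (auto simp: WT orthonormal_system_def simp del: index_mult_mat_vec)
    then have "(W\<^sup>T *\<^sub>v u i) \<bullet> y = 0" using y by simp
    then show ?thesis unfolding w_def using transpose_vec_mult_scalar[OF W y(1) uc[OF i]] by simp
  qed
  have Sw: "S *\<^sub>v w = \<mu> \<cdot>\<^sub>v w"
  proof (rule orthonormal_basis_eqI[OF u])
    fix i assume i: "i < n"
    show "u i \<bullet> (S *\<^sub>v w) = u i \<bullet> (\<mu> \<cdot>\<^sub>v w)"
    proof (cases "i < l")
      case True
      have "u i \<bullet> (S *\<^sub>v w) = (S *\<^sub>v u i) \<bullet> w"
        using adjoint_mult_vec[OF S uc[OF i] w] sym by simp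
      also have "\<dots> = 0" using u0(2) uu0 ulw True uc[OF i] w by simp
      finally show ?thesis using ulw[OF True] uc[OF i] w by simp
    next
      case False
      then obtain j where j: "i = l + j" "j < d" using d i by (metis le_Suc_ex not_less add_less_cancel_left)
      have "W\<^sup>T *\<^sub>v (S *\<^sub>v w) = ?S *\<^sub>v y"
        unfolding w_def using S W y by (simp add: assoc_mult_mat_vec[of _ d n _ d] assoc_mult_mat_vec[of _ n n _ d])
      moreover have "W\<^sup>T *\<^sub>v (\<mu> \<cdot>\<^sub>v w) = \<mu> \<cdot>\<^sub>v y"
        using W w WTW[OF y(1)] unfolding w_def by (simp add: mult_mat_vec[of _ d n])
      ultimately show ?thesis using WT[OF j(2)] y(3) j(1) by metis
    qed
  qed (use S w in auto)
  have "vec_norm2 w = vec_norm2 y"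
    unfolding w_def W_def
    by (rule orthonormal_cols_isometry[OF system_mat_carrier orthonormal_cols_system_mat[OF sysW] y(1)])
  then have w0: "vec_norm2 w \<noteq> 0" using y vec_norm2_eq_0 by simp
  define v where "v = (1 / vec_norm2 w) \<cdot>\<^sub>v w"
  have v: "v \<in> carrier_vec n" "v \<bullet> v = 1"
    unfolding v_def using w normalized_scalar_prod_self[OF w0] by auto
  have "\<forall>i<l. u0 i \<bullet> v = 0" unfolding v_def using ulw uu0 u0(1) w
    by (auto simp: orthonormal_system_def scalar_prod_smult_distrib[of _ n])
  from orthonormal_system_Suc[OF u0(1) v this]
  have "orthonormal_system n (Suc l) (u0(l := v))" .
  moreover have "S *\<^sub>v v = \<mu> \<cdot>\<^sub>v v"
    unfolding v_def using S w by (simp add: mult_mat_vec[of _ n n] Sw smult_smult_assoc mult.commute)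
  then have "\<forall>i<Suc l. S *\<^sub>v (u0(l := v)) i = (ev(l := \<mu>)) i \<cdot>\<^sub>v (u0(l := v)) i"
    using u0(2) by (auto simp: less_Suc_eq)
  ultimately show ?case by blast
qed

text \<open>Sorting puts the eigenvalues into the order that a singular value decomposition demands.\<close>

lemma ex_decreasing_rearrangement:
  fixes f :: "nat \<Rightarrow> real"
  shows "\<exists>p. bij_betw p {..<n} {..<n} \<and> (\<forall>i j. i \<le> j \<longrightarrow> j < n \<longrightarrow> f (p j) \<le> f (p i))"
proof -
  define xs where "xs = sort_key (\<lambda>i. - f i) [0..<n]"
  have xs: "distinct xs" "set xs = {..<n}" "length xs = n" unfolding xs_def by auto
  have "sorted (map (\<lambda>i. - f i) xs)" unfolding xs_def by (rule sorted_sort_key)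
  then have "f (xs ! j) \<le> f (xs ! i)" if "i \<le> j" "j < n" for i j
    using sorted_nth_mono[of "map (\<lambda>i. - f i) xs" i j] that xs(3) by simp
  moreover have "bij_betw ((!) xs) {..<n} {..<n}" using bij_betw_nth[OF xs(1)] xs by auto
  ultimately show ?thesis by blast
qed

text \<open>The left singular vectors are eigenvectors \<open>u\<^sub>i\<close> of \<open>M M\<^sup>T\<close> in order of decreasing eigenvalue;
  the right ones are the normalised \<open>M\<^sup>T u\<^sub>i \<noteq> 0\<close>, completed to an orthonormal basis.\<close>

lemma ex_full_svd:
  assumes M: "M \<in> carrier_mat r c" and rc: "r \<le> c"
  shows "\<exists>U \<Sigma> V. is_full_svd M U \<Sigma> V"
proof -
  let ?S = "M * M\<^sup>T"
  have S: "?S \<in> carrier_mat r r" "?S\<^sup>T = ?S"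
    using M by (auto simp: transpose_mult[of _ r c _ r])
  obtain u0 ev0 where u0: "orthonormal_system r r u0" "\<forall>i<r. ?S *\<^sub>v u0 i = ev0 i \<cdot>\<^sub>v u0 i"
    using symmetric_mat_eigensystem[OF S, of r] by auto
  obtain p where p: "bij_betw p {..<r} {..<r}" "\<And>i j. i \<le> j \<Longrightarrow> j < r \<Longrightarrow> ev0 (p j) \<le> ev0 (p i)"
    using ex_decreasing_rearrangement[of r ev0] by blast
  define u where "u = u0 \<circ> p"
  define ev where "ev = ev0 \<circ> p"
  have pr: "p i < r" if "i < r" for i using p(1) that unfolding bij_betw_def by auto
  have pinj: "p i = p j \<longleftrightarrow> i = j" if "i < r" "j < r" for i j
    using p(1) that unfolding bij_betw_def inj_on_def by auto
  have u: "orthonormal_system r r u"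
    using u0(1) pr pinj unfolding orthonormal_system_def u_def by auto
  have uc: "u i \<in> carrier_vec r" if "i < r" for i
    using u that unfolding orthonormal_system_def by auto
  have Su: "?S *\<^sub>v u i = ev i \<cdot>\<^sub>v u i" if "i < r" for i
    using u0(2) pr[OF that] unfolding u_def ev_def by simp
  have dec: "ev j \<le> ev i" if "i \<le> j" "j < r" for i j using p(2) that unfolding ev_def by simp
  define g where "g i = M\<^sup>T *\<^sub>v u i" for i
  have g: "g i \<in> carrier_vec c" if "i < r" for i unfolding g_def using M uc[OF that] by simp
  have gg: "g i \<bullet> g j = (if i = j then ev i else 0)" if "i < r" "j < r" for i j
  proof -
    have "g i \<bullet> g j = u i \<bullet> (M *\<^sub>v (M\<^sup>T *\<^sub>v u j))"
      unfolding g_def using transpose_vec_mult_scalar[OF M _ uc[OF that(1)]] M uc[OF that(2)] by simp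
    also have "\<dots> = u i \<bullet> (?S *\<^sub>v u j)"
      using M uc[OF that(2)] by (simp add: assoc_mult_mat_vec[of _ r c _ r])
    also have "\<dots> = ev j * (u i \<bullet> u j)"
      using Su uc that by (simp add: scalar_prod_smult_distrib[of _ r])
    also have "\<dots> = (if i = j then ev i else 0)" using u that unfolding orthonormal_system_def by auto
    finally show ?thesis .
  qed
  have nonneg: "0 \<le> ev i" if "i < r" for i
    using gg[OF that that] scalar_prod_self_nonneg[of "g i"] by simp
  \<comment> \<open>the rank of \<open>M\<close>: as the eigenvalues decrease, exactly the first \<open>t\<close> are positive\<close>
  define t where "t = card {i. i < r \<and> 0 < ev i}"
  have tpos: "0 < ev i \<longleftrightarrow> i < t" if "i < r" for i
  proof -
    let ?A = "{i. i < r \<and> 0 < ev i}"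
    have fin: "finite ?A" by simp
    show ?thesis
    proof
      assume "0 < ev i"
      then have "{..i} \<subseteq> ?A" using dec[of _ i] that by force
      then have "card {..i} \<le> t" unfolding t_def by (rule card_mono[OF fin])
      then show "i < t" by simp
    next
      assume "i < t"
      show "0 < ev i"
      proof (rule ccontr)
        assume "\<not> 0 < ev i"
        then have "x < i" if "x \<in> ?A" for x using dec[of i x] that by (cases "i \<le> x") auto
        then have "?A \<subseteq> {..<i}" by blast
        then have "t \<le> card {..<i}" unfolding t_def by (intro card_mono) auto
        then show False using \<open>i < t\<close> by simp
      qed
    qed
  qed
  have tr: "t \<le> r"
    using card_mono[of "{..<r}" "{i. i < r \<and> 0 < ev i}"] unfolding t_def by auto
  have "orthonormal_system c t (\<lambda>i. (1 / sqrt (ev i)) \<cdot>\<^sub>v g i)"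
    unfolding orthonormal_system_def
  proof safe
    fix i j assume "i < t" "j < t"
    then have ij: "i < r" "j < r" using tr by auto
    show "((1 / sqrt (ev i)) \<cdot>\<^sub>v g i) \<bullet> ((1 / sqrt (ev j)) \<cdot>\<^sub>v g j) = (if i = j then 1 else 0)"
      using gg[OF ij] g[OF ij(1)] g[OF ij(2)] tpos[OF ij(1)] \<open>i < t\<close>
      by (auto simp: real_sqrt_mult_self field_simps)
  qed (use g tr in auto)
  from orthonormal_system_extend[OF this order_trans[OF tr rc]]
  obtain v where v: "orthonormal_system c c v" "\<forall>i<t. v i = (1 / sqrt (ev i)) \<cdot>\<^sub>v g i"
    by blast
  have gv: "g i = sqrt (ev i) \<cdot>\<^sub>v v i" if "i < r" for i
  proof (cases "i < t")
    case True
    then show ?thesis using v(2) tpos[OF that] g[OF that] by (simp add: smult_smult_assoc)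
  next
    case False
    then have l0: "ev i = 0" using tpos[OF that] nonneg[OF that] by simp
    then have "g i = 0\<^sub>v c" using gg[OF that that] scalar_prod_self_eq_0[OF g[OF that]] by simp
    moreover have "v i \<in> carrier_vec c" using v(1) that rc unfolding orthonormal_system_def by simp
    ultimately show ?thesis using l0 by (intro eq_vecI) auto
  qed
  define U where "U = system_mat r r u"
  define V where "V = system_mat c c v"
  define \<Sigma> where "\<Sigma> = mat r c (\<lambda>(i, j). if i = j then sqrt (ev i) else 0)"
  have U: "U \<in> carrier_mat r r" "orthonormal_cols U"
    unfolding U_def using orthonormal_cols_system_mat[OF u] by auto
  have V: "V \<in> carrier_mat c c" "orthonormal_cols V"
    unfolding V_def using orthonormal_cols_system_mat[OF v(1)] by auto
  have \<Sigma>: "\<Sigma> \<in> carrier_mat r c" unfolding \<Sigma>_def by simp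
  have UMV: "U\<^sup>T * (M * V) = \<Sigma>"
  proof (rule eq_matI)
    fix i j assume "i < dim_row \<Sigma>" "j < dim_col \<Sigma>"
    then have ij: "i < r" "j < c" using \<Sigma> by auto
    have vj: "v j \<in> carrier_vec c" using v(1) ij unfolding orthonormal_system_def by auto
    have "(U\<^sup>T * (M * V)) $$ (i, j) = u i \<bullet> (M *\<^sub>v v j)"
      using U M V ij col_system_mat[OF u, of i] col_system_mat[OF v(1), of j]
        col_mult2[OF M V(1) ij(2)]
      by (simp add: U_def V_def)
    also have "\<dots> = g i \<bullet> v j"
      unfolding g_def using transpose_vec_mult_scalar[OF M vj uc[OF ij(1)]] by simp
    also have "\<dots> = sqrt (ev i) * (v i \<bullet> v j)" 
      using gv[OF ij(1)] v(1) ij rc vj unfolding orthonormal_system_def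
      by (simp add: smult_scalar_prod_distrib[of _ c])
    also have "\<dots> = \<Sigma> $$ (i, j)"
      using v(1) ij rc unfolding orthonormal_system_def \<Sigma>_def by auto
    finally show "(U\<^sup>T * (M * V)) $$ (i, j) = \<Sigma> $$ (i, j)" .
  qed (use U M V \<Sigma> in auto)
  have "U * \<Sigma> * V\<^sup>T = U * (U\<^sup>T * (M * V)) * V\<^sup>T" unfolding UMV ..
  also have "\<dots> = (U * U\<^sup>T) * M * (V * V\<^sup>T)"
    using U M V by (simp add: assoc_mult_mat[of _ r r _ r _ c] assoc_mult_mat[of _ r r _ c _ c]
        assoc_mult_mat[of _ r c _ c _ c])
  also have "\<dots> = M" using square_orthonormal_cols(1)[OF U] square_orthonormal_cols(1)[OF V] M by simp
  finally have "M = U * \<Sigma> * V\<^sup>T" by simp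
  moreover have "diagonal_mat \<Sigma>" unfolding diagonal_mat_def \<Sigma>_def by auto
  ultimately have "is_full_svd M U \<Sigma> V"
    unfolding is_full_svd_def using M U V \<Sigma> nonneg dec rc by (auto simp: \<Sigma>_def)
  then show ?thesis by blast
qed

section \<open>Smallest singular value and largest principal angle\<close>

lemma map_diag_carrier [simp]: "D \<in> carrier_mat r c \<Longrightarrow> map_diag f D \<in> carrier_mat r c"
  unfolding map_diag_def by auto

lemma map_diag_mult_vec:
  assumes D: "D \<in> carrier_mat r c" and z: "z \<in> carrier_vec c" and i: "i < r"
  shows "(map_diag f D *\<^sub>v z) $ i = (if i < c then f (D $$ (i, i)) * z $ i else 0)"
proof -
  have "(map_diag f D *\<^sub>v z) $ i = (\<Sum>j\<in>{0..<c}. (if i = j then f (D $$ (i, j)) else 0) * z $ j)"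
    using D z i unfolding map_diag_def by (auto simp: scalar_prod_def intro!: sum.cong)
  also have "\<dots> = (\<Sum>j\<in>{0..<c}. if j = i then f (D $$ (i, i)) * z $ i else 0)"
    by (intro sum.cong) auto
  also have "\<dots> = (if i < c then f (D $$ (i, i)) * z $ i else 0)" by (simp add: sum.delta)
  finally show ?thesis .
qed

lemma map_diag_ident:
  assumes "diagonal_mat D"
  shows "map_diag (\<lambda>t. t) D = D"
  using assms unfolding map_diag_def diagonal_mat_def by (intro eq_matI) auto

text \<open>As \<open>M\<^sup>T = V \<Sigma>\<^sup>T U\<^sup>T\<close> with \<open>U\<close>, \<open>V\<close> orthogonal, \<open>\<parallel>M\<^sup>T x\<parallel>\<close> is the length of the vector with entries
  \<open>\<sigma>\<^sub>l (U\<^sup>T x)\<^sub>l\<close>. The hypothesis \<open>r \<le> c\<close> ensures that each of the \<open>r\<close> coordinates has a singular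
  value.\<close>

lemma full_svd_smallest:
  assumes M: "M \<in> carrier_mat r c" and r: "0 < r" "r \<le> c" and svd: "is_full_svd M U \<Sigma> V"
  defines "s \<equiv> \<Sigma> $$ (r - 1, r - 1)"
  shows "0 \<le> s"
    and "x \<in> carrier_vec r \<Longrightarrow> s * vec_norm2 x \<le> vec_norm2 (M\<^sup>T *\<^sub>v x)"
    and "\<exists>x\<in>carrier_vec r. vec_norm2 x = 1 \<and> vec_norm2 (M\<^sup>T *\<^sub>v x) = s"
proof -
  have U: "U \<in> carrier_mat r r" "orthonormal_cols U"
    and V: "V \<in> carrier_mat c c" "orthonormal_cols V"
    and \<Sigma>: "\<Sigma> \<in> carrier_mat r c" "diagonal_mat \<Sigma>"
    and nonneg: "\<forall>i<r. 0 \<le> \<Sigma> $$ (i, i)"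
    and dec: "\<forall>i j. i \<le> j \<longrightarrow> j < r \<longrightarrow> \<Sigma> $$ (j, j) \<le> \<Sigma> $$ (i, i)"
    and MUV: "M = U * \<Sigma> * V\<^sup>T"
    using svd M r unfolding is_full_svd_def by auto
  show s0: "0 \<le> s" unfolding s_def using nonneg r by simp
  have norm: "vec_norm2 (M\<^sup>T *\<^sub>v x) = vec_norm2 (\<Sigma>\<^sup>T *\<^sub>v (U\<^sup>T *\<^sub>v x))" if x: "x \<in> carrier_vec r" for x
  proof -
    have "M\<^sup>T = V * (\<Sigma>\<^sup>T * U\<^sup>T)"
      unfolding MUV using U V \<Sigma>
      by (simp add: transpose_mult[of _ r c _ c] transpose_mult[of _ r r _ c])
    then have "M\<^sup>T *\<^sub>v x = V *\<^sub>v (\<Sigma>\<^sup>T *\<^sub>v (U\<^sup>T *\<^sub>v x))"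
      using U V \<Sigma> x by (simp add: assoc_mult_mat_vec[of _ c c _ r] assoc_mult_mat_vec[of _ c r _ r])
    then show ?thesis using orthonormal_cols_isometry[OF V, of "\<Sigma>\<^sup>T *\<^sub>v (U\<^sup>T *\<^sub>v x)"] \<Sigma> U x by simp
  qed
  have St: "\<Sigma>\<^sup>T = map_diag (\<lambda>t. t) \<Sigma>\<^sup>T"
    using \<Sigma> by (intro map_diag_ident[symmetric]) (auto simp: diagonal_mat_def)
  have Sz: "(\<Sigma>\<^sup>T *\<^sub>v z) $ l = (if l < r then \<Sigma> $$ (l, l) * z $ l else 0)"
    if "z \<in> carrier_vec r" "l < c" for z l
    using map_diag_mult_vec[of "\<Sigma>\<^sup>T" c r z l "\<lambda>t. t"] \<Sigma> that r unfolding St[symmetric] by auto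
  have Szz: "(\<Sigma>\<^sup>T *\<^sub>v z) \<bullet> (\<Sigma>\<^sup>T *\<^sub>v z) = (\<Sum>l\<in>{0..<r}. (\<Sigma> $$ (l, l) * z $ l)\<^sup>2)"
    if z: "z \<in> carrier_vec r" for z
  proof -
    have "(\<Sigma>\<^sup>T *\<^sub>v z) \<bullet> (\<Sigma>\<^sup>T *\<^sub>v z) = (\<Sum>l\<in>{0..<c}. ((\<Sigma>\<^sup>T *\<^sub>v z) $ l)\<^sup>2)"
      using \<Sigma> by (simp add: scalar_prod_def power2_eq_square)
    also have "\<dots> = (\<Sum>l\<in>{0..<c}. if l < r then (\<Sigma> $$ (l, l) * z $ l)\<^sup>2 else 0)"
      using Sz[OF z] by (intro sum.cong) (auto simp del: index_mult_mat_vec)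
    also have "\<dots> = (\<Sum>l\<in>{0..<r}. (\<Sigma> $$ (l, l) * z $ l)\<^sup>2)"
      using r by (intro sum.mono_neutral_cong_right) auto
    finally show ?thesis .
  qed
  show "s * vec_norm2 x \<le> vec_norm2 (M\<^sup>T *\<^sub>v x)" if x: "x \<in> carrier_vec r" for x
  proof -
    let ?z = "U\<^sup>T *\<^sub>v x"
    have z: "?z \<in> carrier_vec r" using U x by simp
    have nz: "vec_norm2 ?z = vec_norm2 x"
      using orthonormal_cols_isometry[of "U\<^sup>T" r r x] square_orthonormal_cols(2)[OF U] U x by simp
    have "s\<^sup>2 * (?z \<bullet> ?z) = (\<Sum>l\<in>{0..<r}. (s * ?z $ l)\<^sup>2)"
      using U x by (simp add: scalar_prod_def[of ?z ?z] sum_distrib_left power2_eq_square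
          mult_ac del: index_mult_mat_vec)
    also have "\<dots> \<le> (\<Sum>l\<in>{0..<r}. (\<Sigma> $$ (l, l) * ?z $ l)\<^sup>2)"
    proof (intro sum_mono)
      fix l assume "l \<in> {0..<r}"
      then have "s \<le> \<Sigma> $$ (l, l)" unfolding s_def using dec r by auto
      then have "s\<^sup>2 \<le> (\<Sigma> $$ (l, l))\<^sup>2" using s0 by (intro power_mono)
      then show "(s * ?z $ l)\<^sup>2 \<le> (\<Sigma> $$ (l, l) * ?z $ l)\<^sup>2"
        by (simp add: power_mult_distrib mult_right_mono del: index_mult_mat_vec)
    qed
    finally have "(s * vec_norm2 ?z)\<^sup>2 \<le> (vec_norm2 (M\<^sup>T *\<^sub>v x))\<^sup>2"
      unfolding norm[OF x] by (simp only: power_mult_distrib vec_norm2_sq Szz[OF z])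
    then have "s * vec_norm2 ?z \<le> vec_norm2 (M\<^sup>T *\<^sub>v x)" by (rule power2_le_imp_le) simp
    then show ?thesis using nz by simp
  qed
  let ?e = "unit_vec r (r - 1)"
  have e: "?e \<in> carrier_vec r" by simp
  have ne: "vec_norm2 ?e = 1" using r by (simp add: vec_norm2_def)
  let ?x = "U *\<^sub>v ?e"
  have x: "?x \<in> carrier_vec r" using U e by simp
  have Ux: "U\<^sup>T *\<^sub>v ?x = ?e" by (rule orthonormal_cols_transpose_mult[OF U e])
  have "(\<Sigma>\<^sup>T *\<^sub>v ?e) \<bullet> (\<Sigma>\<^sup>T *\<^sub>v ?e) = (\<Sum>l\<in>{0..<r}. if l = r - 1 then s\<^sup>2 else 0)"
    unfolding Szz[OF e] by (intro sum.cong) (auto simp: s_def)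
  also have "\<dots> = s\<^sup>2" using r by (simp add: sum.delta)
  finally have "vec_norm2 (M\<^sup>T *\<^sub>v ?x) = s"
    unfolding norm[OF x] Ux using s0 by (simp add: vec_norm2_def)
  moreover have "vec_norm2 ?x = 1" using orthonormal_cols_isometry[OF U e] ne by simp
  ultimately show "\<exists>x\<in>carrier_vec r. vec_norm2 x = 1 \<and> vec_norm2 (M\<^sup>T *\<^sub>v x) = s" using x by blast
qed

text \<open>Every decomposition yields the same minimum of \<open>\<parallel>M\<^sup>T x\<parallel>\<close> over unit vectors as its last singular
  value, so the description in \<^const>\<open>sing_val\<close> has a unique solution.\<close>

lemma smallest_sing_val:
  assumes M: "M \<in> carrier_mat r c" and r: "0 < r" "r \<le> c"
  shows "0 \<le> sing_val M (r - 1)"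
    and "x \<in> carrier_vec r \<Longrightarrow> sing_val M (r - 1) * vec_norm2 x \<le> vec_norm2 (M\<^sup>T *\<^sub>v x)"
    and "\<exists>x\<in>carrier_vec r. vec_norm2 x = 1 \<and> vec_norm2 (M\<^sup>T *\<^sub>v x) = sing_val M (r - 1)"
proof -
  obtain U \<Sigma> V where svd: "is_full_svd M U \<Sigma> V" using ex_full_svd[OF M r(2)] by blast
  have le: "\<Sigma>1 $$ (r - 1, r - 1) \<le> \<Sigma>2 $$ (r - 1, r - 1)"
    if 1: "is_full_svd M U1 \<Sigma>1 V1" and 2: "is_full_svd M U2 \<Sigma>2 V2" for U1 \<Sigma>1 V1 U2 \<Sigma>2 V2
  proof -
    obtain x where x: "x \<in> carrier_vec r" "vec_norm2 x = 1"
        "vec_norm2 (M\<^sup>T *\<^sub>v x) = \<Sigma>2 $$ (r - 1, r - 1)"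
      using full_svd_smallest(3)[OF M r 2] by blast
    then show ?thesis using full_svd_smallest(2)[OF M r 1 x(1)] by simp
  qed
  have "sing_val M (r - 1) = \<Sigma> $$ (r - 1, r - 1)"
    unfolding sing_val_def
  proof (rule the_equality)
    show "\<exists>U' \<Sigma>' V'. is_full_svd M U' \<Sigma>' V' \<and> \<Sigma> $$ (r - 1, r - 1) = \<Sigma>' $$ (r - 1, r - 1)"
      using svd by blast
  next
    fix s assume "\<exists>U' \<Sigma>' V'. is_full_svd M U' \<Sigma>' V' \<and> s = \<Sigma>' $$ (r - 1, r - 1)"
    then show "s = \<Sigma> $$ (r - 1, r - 1)" using le svd by (blast intro: antisym)
  qed
  then show "0 \<le> sing_val M (r - 1)"
    and "x \<in> carrier_vec r \<Longrightarrow> sing_val M (r - 1) * vec_norm2 x \<le> vec_norm2 (M\<^sup>T *\<^sub>v x)"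
    and "\<exists>x\<in>carrier_vec r. vec_norm2 x = 1 \<and> vec_norm2 (M\<^sup>T *\<^sub>v x) = sing_val M (r - 1)"
    using full_svd_smallest[OF M r svd] by auto
qed

text \<open>The cosine of the largest angle is the smallest length to which the projection to the range
  of \<open>Q\<close> shrinks a unit vector in the range of \<open>W\<close>. This length depends only on the two ranges, so
  that the bases picked in \<^const>\<open>principal_angles\<close> can be exchanged for \<open>Q\<close> and \<open>W\<close>.\<close>

lemma largest_principal_angle:
  assumes Q: "Q \<in> carrier_mat n c" "orthonormal_cols Q"
    and W: "W \<in> carrier_mat n r" "orthonormal_cols W" and r: "0 < r" "r \<le> c"
  defines "P \<equiv> principal_angles n (mat_range Q) (mat_range W)"
  shows "P \<in> carrier_mat r r"
    and "\<exists>\<sigma>\<ge>0. P $$ (r - 1, r - 1) = arccos \<sigma> \<and>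
      (\<forall>x\<in>carrier_vec r. \<sigma> * vec_norm2 x \<le> vec_norm2 (Q\<^sup>T *\<^sub>v (W *\<^sub>v x))) \<and>
      (\<exists>x\<in>carrier_vec r. vec_norm2 x = 1 \<and> vec_norm2 (Q\<^sup>T *\<^sub>v (W *\<^sub>v x)) = \<sigma>)"
proof -
  define Q' where "Q' = (SOME Q'. is_orthonormal_basis n (mat_range Q) Q')"
  define B where "B = (SOME B. is_orthonormal_basis n (mat_range W) B)"
  have "is_orthonormal_basis n (mat_range Q) Q'"
    unfolding Q'_def by (rule someI[of _ Q]) (use Q in \<open>simp add: is_orthonormal_basis_def\<close>)
  then have Q': "dim_row Q' = n" "orthonormal_cols Q'" "mat_range Q' = mat_range Q"
    unfolding is_orthonormal_basis_def by auto
  have "is_orthonormal_basis n (mat_range W) B"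
    unfolding B_def by (rule someI[of _ W]) (use W in \<open>simp add: is_orthonormal_basis_def\<close>)
  then have B: "dim_row B = n" "orthonormal_cols B" "mat_range B = mat_range W"
    unfolding is_orthonormal_basis_def by auto
  have "dim_col Q' = c"
    by (rule orthonormal_cols_eq_of_range_eq[OF carrier_matI[OF Q'(1) refl] Q'(2) Q Q'(3)])
  then have Q'c: "Q' \<in> carrier_mat n c" using Q' by auto
  have "dim_col B = r"
    by (rule orthonormal_cols_eq_of_range_eq[OF carrier_matI[OF B(1) refl] B(2) W B(3)])
  then have Bc: "B \<in> carrier_mat n r" using B by auto
  let ?M = "B\<^sup>T * Q'"
  have M: "?M \<in> carrier_mat r c" using Bc Q'c by simp
  have P: "P = mat_diag r (\<lambda>j. arccos (sing_val ?M j))"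
    unfolding P_def principal_angles_def Let_def Q'_def[symmetric] B_def[symmetric] using Bc by simp
  then show "P \<in> carrier_mat r r" by simp
  have Mx: "vec_norm2 (?M\<^sup>T *\<^sub>v x) = vec_norm2 (Q\<^sup>T *\<^sub>v (B *\<^sub>v x))" if x: "x \<in> carrier_vec r" for x
  proof -
    have "?M\<^sup>T *\<^sub>v x = Q'\<^sup>T *\<^sub>v (B *\<^sub>v x)"
      using Bc Q'c x by (simp add: transpose_mult[of _ r n _ c] assoc_mult_mat_vec[of _ c n _ r])
    then show ?thesis using projection_norm_cong[OF Q'c Q'(2) Q Q'(3), of "B *\<^sub>v x"] Bc x by simp
  qed
  have transfer: "\<exists>y\<in>carrier_vec r. F *\<^sub>v y = E *\<^sub>v x \<and> vec_norm2 y = vec_norm2 x"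
    if x: "x \<in> carrier_vec r" and E: "E \<in> carrier_mat n r" "orthonormal_cols E"
      and F: "F \<in> carrier_mat n r" "orthonormal_cols F" and EF: "mat_range E = mat_range F" for x E F
  proof -
    have "E *\<^sub>v x \<in> mat_range F" using mat_range_memI[OF E(1) x] EF by simp
    then obtain y where y: "y \<in> carrier_vec r" "E *\<^sub>v x = F *\<^sub>v y"
      using F(1) unfolding mat_range_eq by auto
    then have "vec_norm2 y = vec_norm2 x"
      using orthonormal_cols_isometry[OF E x] orthonormal_cols_isometry[OF F y(1)] by simp
    then show ?thesis using y by auto
  qed
  let ?\<sigma> = "sing_val ?M (r - 1)"
  have "P $$ (r - 1, r - 1) = arccos ?\<sigma>" unfolding P using r by (simp add: mat_diag_def)
  moreover have "?\<sigma> * vec_norm2 x \<le> vec_norm2 (Q\<^sup>T *\<^sub>v (W *\<^sub>v x))" if "x \<in> carrier_vec r" for x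
    using transfer[OF that W Bc B(2) B(3)[symmetric]] smallest_sing_val(2)[OF M r] Mx by metis
  moreover have "\<exists>x\<in>carrier_vec r. vec_norm2 x = 1 \<and> vec_norm2 (Q\<^sup>T *\<^sub>v (W *\<^sub>v x)) = ?\<sigma>"
  proof -
    obtain x where x: "x \<in> carrier_vec r" "vec_norm2 x = 1" "vec_norm2 (?M\<^sup>T *\<^sub>v x) = ?\<sigma>"
      using smallest_sing_val(3)[OF M r] by blast
    obtain y where "y \<in> carrier_vec r" "W *\<^sub>v y = B *\<^sub>v x" "vec_norm2 y = vec_norm2 x"
      using transfer[OF x(1) Bc B(2) W B(3)] by blast
    then show ?thesis using x Mx[OF x(1)] by (intro bexI[of _ y]) auto
  qed
  ultimately show "\<exists>\<sigma>\<ge>0. P $$ (r - 1, r - 1) = arccos \<sigma> \<and>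
      (\<forall>x\<in>carrier_vec r. \<sigma> * vec_norm2 x \<le> vec_norm2 (Q\<^sup>T *\<^sub>v (W *\<^sub>v x))) \<and>
      (\<exists>x\<in>carrier_vec r. vec_norm2 x = 1 \<and> vec_norm2 (Q\<^sup>T *\<^sub>v (W *\<^sub>v x)) = \<sigma>)"
    using smallest_sing_val(1)[OF M r] by blast
qed

section \<open>Pseudoinverse of a matrix of full row rank\<close>

text \<open>\<open>M P\<close> and \<open>M P'\<close> are symmetric idempotents with the same range, hence equal, and so are \<open>P M\<close> and
  \<open>P' M\<close>; then \<open>P = P M P = P' M P' = P'\<close>.\<close>

lemma is_pinv_unique:
  assumes P: "is_pinv M P" and P': "is_pinv M P'"
  shows "P = P'"
proof -
  obtain r c where M: "M \<in> carrier_mat r c" by blast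
  have Pc: "P \<in> carrier_mat c r" and P'c: "P' \<in> carrier_mat c r"
    using P P' M unfolding is_pinv_def by auto
  note assoc = assoc_mult_mat[of _ r c _ r _ c] assoc_mult_mat[of _ r c _ r _ r]
    assoc_mult_mat[of _ r c _ c _ r] assoc_mult_mat[of _ r c _ c _ c]
    assoc_mult_mat[of _ r r _ c _ r] assoc_mult_mat[of _ r r _ r _ c]
    assoc_mult_mat[of _ r r _ c _ c] assoc_mult_mat[of _ c r _ c _ r]
    assoc_mult_mat[of _ c r _ c _ c] assoc_mult_mat[of _ c r _ r _ c]
    assoc_mult_mat[of _ c r _ r _ r] assoc_mult_mat[of _ c c _ r _ c]
    assoc_mult_mat[of _ c c _ c _ r] assoc_mult_mat[of _ c c _ r _ r]
  have "M * P = (M * P' * M) * P" using P' unfolding is_pinv_def by simp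
  also have "\<dots> = (M * P') * (M * P)" using M Pc P'c by (simp add: assoc)
  finally have 1: "M * P = (M * P') * (M * P)" .
  have "M * P = (M * P)\<^sup>T" using P unfolding is_pinv_def by simp
  also have "\<dots> = (M * P)\<^sup>T * (M * P')\<^sup>T"
    using M Pc P'c by (subst 1, subst transpose_mult[of _ r r _ r]) auto
  also have "\<dots> = (M * P) * (M * P')" using P P' unfolding is_pinv_def by simp
  also have "\<dots> = (M * P * M) * P'" using M Pc P'c by (simp add: assoc)
  also have "\<dots> = M * P'" using P unfolding is_pinv_def by simp
  finally have MP: "M * P = M * P'" .
  have "P * M = P * (M * P' * M)" using P' unfolding is_pinv_def by simp
  also have "\<dots> = (P * M) * (P' * M)" using M Pc P'c by (simp add: assoc)
  finally have 2: "P * M = (P * M) * (P' * M)" .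
  have "P * M = (P * M)\<^sup>T" using P unfolding is_pinv_def by simp
  also have "\<dots> = (P' * M)\<^sup>T * (P * M)\<^sup>T"
    using M Pc P'c by (subst 2, subst transpose_mult[of _ c c _ c]) auto
  also have "\<dots> = (P' * M) * (P * M)" using P P' unfolding is_pinv_def by simp
  also have "\<dots> = P' * (M * P * M)" using M Pc P'c by (simp add: assoc)
  also have "\<dots> = P' * M" using P unfolding is_pinv_def by simp
  finally have PM: "P * M = P' * M" .
  have "P = P * M * P" using P unfolding is_pinv_def by simp
  also have "\<dots> = P' * (M * P)" unfolding PM using M Pc P'c by (simp add: assoc)
  also have "\<dots> = P' * M * P'" unfolding MP using M P'c by simp
  also have "\<dots> = P'" using P' unfolding is_pinv_def by simp
  finally show ?thesis .
qed

lemma full_row_rank_mat_range: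
  assumes G: "G \<in> carrier_mat k s" and rank: "vec_space.rank k G = k"
  shows "carrier_vec k \<subseteq> mat_range G"
proof -
  interpret vec_space "TYPE(real)" k .
  obtain S where S: "maximal S (\<lambda>T. T \<subseteq> set (cols G) \<and> lin_indpt T)"
    using maximal_exists[of "(\<lambda>T. T \<subseteq> set (cols G) \<and> lin_indpt T)" "card (set (cols G))" "{}"]
    by (meson List.finite_set card_mono empty_iff empty_subsetI finite_lin_indpt2 rev_finite_subset)
  have Sc: "S \<subseteq> set (cols G)" "lin_indpt S" using S unfolding maximal_def by auto
  have cc: "set (cols G) \<subseteq> carrier_vec k" using G cols_dim by blast
  have "card S = k" using rank_card_indpt[OF G S] rank by simp
  then have "basis S"
    using Sc cc dim_is_n by (intro dim_li_is_basis) (auto intro: finite_subset[OF Sc(1)])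
  then have "carrier_vec k = span S" unfolding basis_def by simp
  also have "\<dots> \<subseteq> span (set (cols G))" by (rule span_is_monotone[OF Sc(1)])
  finally show ?thesis unfolding carrier_matD(1)[OF G] col_space_def .
qed

text \<open>Full row rank makes \<open>G\<^sup>T\<close> injective and thus \<open>G G\<^sup>T\<close> invertible. With \<open>H\<close> its inverse, \<open>G\<^sup>T H\<close> is
  a right inverse of \<open>G\<close> that satisfies the Penrose equations. That its values lie in the range of
  \<open>G\<^sup>T\<close> is what the bound by the tangent uses.\<close>

lemma pinv_full_row_rank:
  assumes G: "G \<in> carrier_mat k s" and rank: "vec_space.rank k G = k"
  shows "\<exists>H\<in>carrier_mat k k. pinv G = G\<^sup>T * H \<and> G * (G\<^sup>T * H) = 1\<^sub>m k"
    and "y \<in> carrier_vec k \<Longrightarrow> G\<^sup>T *\<^sub>v y = 0\<^sub>v s \<Longrightarrow> y = 0\<^sub>v k"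
proof -
  show inj: "y = 0\<^sub>v k" if y: "y \<in> carrier_vec k" "G\<^sup>T *\<^sub>v y = 0\<^sub>v s" for y
  proof -
    obtain x where x: "x \<in> carrier_vec s" "y = G *\<^sub>v x"
      using full_row_rank_mat_range[OF assms] y G unfolding mat_range_eq by auto
    have "y \<bullet> y = (G\<^sup>T *\<^sub>v y) \<bullet> x" using transpose_vec_mult_scalar[OF G x(1) y(1)] x by simp
    then show ?thesis using y x scalar_prod_self_eq_0[OF y(1)] by simp
  qed
  let ?S = "G * G\<^sup>T"
  have S: "?S \<in> carrier_mat k k" "?S\<^sup>T = ?S" using G by (auto simp: transpose_mult[of _ k s _ k])
  have "det ?S \<noteq> 0"
  proof
    assume "det ?S = 0"
    then obtain v where v: "v \<in> carrier_vec k" "v \<noteq> 0\<^sub>v k" "?S *\<^sub>v v = 0\<^sub>v k"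
      using det_0_iff_vec_prod_zero[OF S(1)] by auto
    have Gv: "G\<^sup>T *\<^sub>v v \<in> carrier_vec s" using G v by simp
    have "(G\<^sup>T *\<^sub>v v) \<bullet> (G\<^sup>T *\<^sub>v v) = v \<bullet> (?S *\<^sub>v v)"
      using transpose_vec_mult_scalar[OF G Gv v(1)] G v
      by (simp add: assoc_mult_mat_vec[of _ k s _ k])
    then have "G\<^sup>T *\<^sub>v v = 0\<^sub>v s" using v scalar_prod_self_eq_0[OF Gv] by simp
    then show False using inj v by blast
  qed
  then obtain H where H: "H \<in> carrier_mat k k" "?S * H = 1\<^sub>m k" "H * ?S = 1\<^sub>m k"
    using det_non_zero_imp_unit[OF S(1)] unfolding Units_def ring_mat_def by auto
  have HT: "H\<^sup>T = H"
  proof -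
    have "H\<^sup>T * ?S = (?S * H)\<^sup>T"
      using transpose_mult[OF S(1) H(1)] S(2) by simp
    then have HS: "H\<^sup>T * ?S = 1\<^sub>m k" using H by simp
    have "H\<^sup>T = H\<^sup>T * (?S * H)" using H by simp
    also have "\<dots> = (H\<^sup>T * ?S) * H" using H S by (subst assoc_mult_mat[of _ k k _ k _ k]) auto
    also have "\<dots> = H" using H HS by simp
    finally show ?thesis .
  qed
  let ?P = "G\<^sup>T * H"
  have P: "?P \<in> carrier_mat s k" using G H(1) by simp
  have GP: "G * ?P = 1\<^sub>m k"
    using assoc_mult_mat[OF G _ H(1), of "G\<^sup>T"] G H(2) by simp
  have "(?P * G)\<^sup>T = G\<^sup>T * (H\<^sup>T * G)"
    using transpose_mult[OF P G] transpose_mult[OF _ H(1), of "G\<^sup>T" s] G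
    by (simp only: transpose_carrier_mat transpose_transpose)
  also have "\<dots> = ?P * G" unfolding HT
    by (rule assoc_mult_mat[symmetric, of _ s k _ k _ s]) (use G H(1) in auto)
  finally have sym: "(?P * G)\<^sup>T = ?P * G" .
  have "?P * G * ?P = ?P * (G * ?P)" 
    by (rule assoc_mult_mat[of _ s k _ s _ k]) (use G P in auto)
  then have "is_pinv G ?P"
    unfolding is_pinv_def using G P GP sym by auto
  then have "pinv G = ?P" unfolding pinv_def using is_pinv_unique by blast
  then show "\<exists>H\<in>carrier_mat k k. pinv G = G\<^sup>T * H \<and> G * (G\<^sup>T * H) = 1\<^sub>m k" using H GP by blast
qed

section \<open>Odd polynomials of the singular values and the Krylov space\<close>

lemma krylov_block_mem:
  assumes A: "A \<in> carrier_mat m n" and X: "X \<in> carrier_mat n s" and y: "y \<in> carrier_vec s"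
    and j: "j \<le> q"
  shows "((A * A\<^sup>T) ^\<^sub>m j * (A * X)) *\<^sub>v y \<in> mat_range (krylov_mat A X q)"
proof -
  let ?N = "\<lambda>j. (A * A\<^sup>T) ^\<^sub>m j * (A * X)"
  let ?vs = "concat (map (\<lambda>j. cols (?N j)) [0..<Suc q])"
  have N: "?N j \<in> carrier_mat m s" for j using A X pow_carrier_mat[of "A * A\<^sup>T" m j] by auto
  have K: "krylov_mat A X q = mat_of_cols m ?vs"
    unfolding krylov_mat_def carrier_matD(1)[OF A] ..
  have Kc: "krylov_mat A X q \<in> carrier_mat m (length ?vs)" unfolding K by (rule mat_of_cols_carrier(1))
  have "set (cols (?N j)) \<subseteq> carrier_vec m" for j
    using cols_dim[of "?N j"] unfolding carrier_matD(1)[OF N] .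
  then have vs: "set ?vs \<subseteq> carrier_vec m" unfolding set_concat set_map by blast
  have "col (?N j) i \<in> mat_range (krylov_mat A X q)" if "i < s" for i
  proof -
    have "col (?N j) i \<in> set (cols (?N j))" 
      using that carrier_matD(2)[OF N[of j]] by (metis cols_length cols_nth nth_mem)
    then have "col (?N j) i \<in> set ?vs"
      using j unfolding set_concat set_map set_upt by (auto simp: less_Suc_eq_le simp del: upt_Suc)
    then have "col (?N j) i \<in> set (cols (krylov_mat A X q))"
      unfolding K by (subst cols_mat_of_cols[OF vs])
    then obtain l where "l < length ?vs" "col (?N j) i = col (krylov_mat A X q) l"
      using carrier_matD(2)[OF Kc] by (metis cols_length cols_nth in_set_conv_nth)
    then show ?thesis
      using mat_range_memI[OF Kc, of "unit_vec (length ?vs) l"] col_eq_mult_unit_vec[OF Kc, of l]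
      by simp
  qed
  from mat_range_subsetI[OF N Kc this] show ?thesis using mat_range_memI[OF N y, of j] by blast
qed

text \<open>\<open>A = U \<Sigma> V\<^sup>T\<close> turns \<open>(A A\<^sup>T)\<^sup>j A\<close> into \<open>U (\<Sigma> \<Sigma>\<^sup>T)\<^sup>j \<Sigma> V\<^sup>T\<close>, and a diagonal \<open>\<Sigma>\<close> is multiplied
  entry by entry. The induction strips a factor on the right and applies the hypothesis to
  \<open>A\<^sup>T A w\<close>.\<close>

lemma svd_odd_power:
  assumes A: "A \<in> carrier_mat m n" and svd: "is_full_svd A U \<Sigma> V" and w: "w \<in> carrier_vec n"
  shows "(A * A\<^sup>T) ^\<^sub>m j *\<^sub>v (A *\<^sub>v w) = U *\<^sub>v (map_diag (\<lambda>t. t ^ (2 * j + 1)) \<Sigma> *\<^sub>v (V\<^sup>T *\<^sub>v w))"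
  using w
proof (induction j arbitrary: w)
  have U: "U \<in> carrier_mat m m" "orthonormal_cols U"
    and V: "V \<in> carrier_mat n n" "orthonormal_cols V"
    and \<Sigma>: "\<Sigma> \<in> carrier_mat m n" "diagonal_mat \<Sigma>" and AUV: "A = U * \<Sigma> * V\<^sup>T"
    using svd A unfolding is_full_svd_def by auto
  have Aw: "A *\<^sub>v w = U *\<^sub>v (\<Sigma> *\<^sub>v (V\<^sup>T *\<^sub>v w))" if "w \<in> carrier_vec n" for w
    unfolding AUV using U V \<Sigma> that
    by (simp add: assoc_mult_mat_vec[of _ m n _ n] assoc_mult_mat_vec[of _ m m _ n])
  have ATw: "A\<^sup>T *\<^sub>v w = V *\<^sub>v (\<Sigma>\<^sup>T *\<^sub>v (U\<^sup>T *\<^sub>v w))" if "w \<in> carrier_vec m" for w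
    unfolding AUV using U V \<Sigma> that
    by (simp add: transpose_mult[of _ m n _ n] transpose_mult[of _ m m _ n]
        assoc_mult_mat_vec[of _ n n _ m] assoc_mult_mat_vec[of _ n m _ m])
  {
    case 0
    have "1\<^sub>m m *\<^sub>v (A *\<^sub>v w) = A *\<^sub>v w" using A 0 by simp
    then show ?case using A Aw[OF 0] map_diag_ident[OF \<Sigma>(2)] by simp
  next
    case (Suc j)
    let ?w = "A\<^sup>T *\<^sub>v (A *\<^sub>v w)"
    let ?z = "V\<^sup>T *\<^sub>v w"
    have w: "?w \<in> carrier_vec n" using A Suc.prems by simp
    have z: "?z \<in> carrier_vec n" using V Suc.prems by simp
    have Sz: "\<Sigma> *\<^sub>v ?z \<in> carrier_vec m" using \<Sigma> z by simp
    have SSz: "\<Sigma>\<^sup>T *\<^sub>v (\<Sigma> *\<^sub>v ?z) \<in> carrier_vec n" using \<Sigma> z by simp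
    have "?w = V *\<^sub>v (\<Sigma>\<^sup>T *\<^sub>v (\<Sigma> *\<^sub>v ?z))"
      using ATw[OF mult_mat_vec_carrier[OF A Suc.prems]]
      unfolding Aw[OF Suc.prems] orthonormal_cols_transpose_mult[OF U Sz] .
    then have Vw: "V\<^sup>T *\<^sub>v ?w = \<Sigma>\<^sup>T *\<^sub>v (\<Sigma> *\<^sub>v ?z)"
      using orthonormal_cols_transpose_mult[OF V SSz] by simp
    have St: "\<Sigma>\<^sup>T = map_diag (\<lambda>t. t) \<Sigma>\<^sup>T" and S: "\<Sigma> = map_diag (\<lambda>t. t) \<Sigma>"
      using \<Sigma> by (auto intro!: map_diag_ident[symmetric] simp: diagonal_mat_def)
    have 1: "(\<Sigma> *\<^sub>v ?z) $ i = (if i < n then \<Sigma> $$ (i, i) * ?z $ i else 0)" if "i < m" for i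
      using map_diag_mult_vec[OF \<Sigma>(1) z that, of "\<lambda>t. t"] S by simp
    have 2: "(\<Sigma>\<^sup>T *\<^sub>v (\<Sigma> *\<^sub>v ?z)) $ i = (if i < m then \<Sigma> $$ (i, i) * (\<Sigma> *\<^sub>v ?z) $ i else 0)"
      if "i < n" for i
      using map_diag_mult_vec[of "\<Sigma>\<^sup>T" n m "\<Sigma> *\<^sub>v ?z" i "\<lambda>t. t"] Sz that \<Sigma>
      by (simp only: St[symmetric]) simp
    have "map_diag (\<lambda>t. t ^ (2 * j + 1)) \<Sigma> *\<^sub>v (\<Sigma>\<^sup>T *\<^sub>v (\<Sigma> *\<^sub>v ?z))
        = map_diag (\<lambda>t. t ^ (2 * Suc j + 1)) \<Sigma> *\<^sub>v ?z" (is "?l = ?r")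
    proof (rule eq_vecI)
      fix i assume "i < dim_vec ?r"
      then have i: "i < m" using \<Sigma> by (simp add: map_diag_def)
      show "?l $ i = ?r $ i"
        unfolding map_diag_mult_vec[OF \<Sigma>(1) SSz i] map_diag_mult_vec[OF \<Sigma>(1) z i]
        using i 1 2 by (simp del: index_mult_mat_vec)
    qed (use \<Sigma> in \<open>simp add: map_diag_def\<close>)
    moreover have "(A * A\<^sup>T) ^\<^sub>m Suc j *\<^sub>v (A *\<^sub>v w) = (A * A\<^sup>T) ^\<^sub>m j *\<^sub>v (A *\<^sub>v ?w)"
      using A Suc.prems pow_carrier_mat[of "A * A\<^sup>T" m j]
      by (simp add: assoc_mult_mat_vec[of _ m m _ m] assoc_mult_mat_vec[of _ m n _ m])
    ultimately show ?case using Suc.IH[OF w] Vw by simp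
  }
qed

text \<open>By linearity in \<open>f\<close> it suffices to check the odd powers \<open>t\<^bsup>2j+1\<^esup>\<close> with \<open>j \<le> q\<close>, for which
  \<open>U f(\<Sigma>) V\<^sup>T = (A A\<^sup>T)\<^sup>j A\<close>.\<close>

lemma odd_poly_mem_krylov:
  assumes A: "A \<in> carrier_mat m n" and X: "X \<in> carrier_mat n s" and y: "y \<in> carrier_vec s"
    and svd: "is_full_svd A U \<Sigma> V"
    and deg: "degree \<phi> \<le> 2 * q + 1" and odd: "\<And>j. even j \<Longrightarrow> coeff \<phi> j = 0"
  shows "U *\<^sub>v (map_diag (poly \<phi>) \<Sigma> *\<^sub>v (V\<^sup>T *\<^sub>v (X *\<^sub>v y))) \<in> mat_range (krylov_mat A X q)"
proof -
  have U: "U \<in> carrier_mat m m" and V: "V \<in> carrier_mat n n" and \<Sigma>: "\<Sigma> \<in> carrier_mat m n"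
    using svd A unfolding is_full_svd_def by auto
  let ?K = "mat_range (krylov_mat A X q)"
  obtain d where K: "krylov_mat A X q \<in> carrier_mat m d"
    unfolding krylov_mat_def carrier_matD(1)[OF A] using mat_of_cols_carrier(1) by blast
  have Xy: "X *\<^sub>v y \<in> carrier_vec n" using X y by simp
  let ?z = "V\<^sup>T *\<^sub>v (X *\<^sub>v y)"
  have z: "?z \<in> carrier_vec n" using V Xy by simp
  define F where "F f = U *\<^sub>v (map_diag f \<Sigma> *\<^sub>v ?z)" for f
  have Dz: "map_diag f \<Sigma> *\<^sub>v ?z \<in> carrier_vec m" for f using \<Sigma> z by (simp add: mult_mat_vec_carrier[of _ m n])
  have F_smult: "F (\<lambda>t. a * f t) = a \<cdot>\<^sub>v F f" for a f
  proof -
    have "map_diag (\<lambda>t. a * f t) \<Sigma> *\<^sub>v ?z = a \<cdot>\<^sub>v (map_diag f \<Sigma> *\<^sub>v ?z)"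
      using map_diag_mult_vec[OF \<Sigma> z]
      by (intro eq_vec_carrierI[of _ m]) (simp_all add: Dz carrier_vecD[OF Dz] del: index_mult_mat_vec dim_mult_mat_vec)
    then show ?thesis unfolding F_def using mult_mat_vec[OF U Dz] by simp
  qed
  have F_add: "F (\<lambda>t. f t + g t) = F f + F g" for f g
  proof -
    have "map_diag (\<lambda>t. f t + g t) \<Sigma> *\<^sub>v ?z = map_diag f \<Sigma> *\<^sub>v ?z + map_diag g \<Sigma> *\<^sub>v ?z"
      using map_diag_mult_vec[OF \<Sigma> z]
      by (intro eq_vec_carrierI[of _ m])
        (simp_all add: Dz carrier_vecD[OF Dz] distrib_right del: index_mult_mat_vec dim_mult_mat_vec)
    then show ?thesis unfolding F_def using mult_add_distrib_mat_vec[OF U Dz Dz] by simp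
  qed
  have F_power: "F (\<lambda>t. t ^ (2 * j + 1)) \<in> ?K" if "j \<le> q" for j
  proof -
    have "((A * A\<^sup>T) ^\<^sub>m j * (A * X)) *\<^sub>v y = (A * A\<^sup>T) ^\<^sub>m j *\<^sub>v (A *\<^sub>v (X *\<^sub>v y))"
      using A X y pow_carrier_mat[of "A * A\<^sup>T" m j]
      by (simp add: assoc_mult_mat_vec[of _ m m _ s] assoc_mult_mat_vec[of _ m n _ s])
    then show ?thesis
      using krylov_block_mem[OF A X y that] svd_odd_power[OF A svd Xy, of j] unfolding F_def by simp
  qed
  have F_term: "F (\<lambda>t. coeff \<phi> i * t ^ i) \<in> ?K" if "i \<le> 2 * q + 1" for i
  proof (cases "even i")
    case True
    have "F (\<lambda>t. coeff \<phi> i * t ^ i) = F (\<lambda>t. 0 * t ^ (2 * 0 + 1))" using odd[OF True] by simp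
    also have "\<dots> \<in> ?K" unfolding F_smult by (rule mat_range_smult[OF K F_power]) simp
    finally show ?thesis .
  next
    case False
    then obtain j where j: "i = 2 * j + 1" by (auto elim: oddE)
    then have "j \<le> q" using that by simp
    then show ?thesis unfolding F_smult j by (intro mat_range_smult[OF K] F_power)
  qed
  have "F (\<lambda>t. \<Sum>i\<le>N. coeff \<phi> i * t ^ i) \<in> ?K" if "N \<le> 2 * q + 1" for N
    using that
  proof (induction N)
    case 0
    then show ?case using F_term[of 0] by simp
  next
    case (Suc N)
    then show ?case using F_term[of "Suc N"] by (simp add: F_add mat_range_add[OF K])
  qed
  moreover have "poly \<phi> = (\<lambda>t. \<Sum>i\<le>degree \<phi>. coeff \<phi> i * t ^ i)" by (simp add: poly_altdef fun_eq_iff)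
  ultimately show ?thesis using deg unfolding F_def by simp
qed

section \<open>The angle bounds\<close>

lemma col_mat_of_cols_append:
  assumes B: "B \<in> carrier_mat n b" and C: "C \<in> carrier_mat n c" and i: "i < b + c"
  shows "col (mat_of_cols n (cols B @ cols C)) i = (if i < b then col B i else col C (i - b))"
proof -
  have nth: "(cols B @ cols C) ! i = (if i < b then col B i else col C (i - b))"
    using carrier_matD[OF B] carrier_matD[OF C] i by (simp add: nth_append)
  moreover have "\<dots> \<in> carrier_vec n"
    using carrier_matD[OF B] carrier_matD[OF C] by (auto intro!: carrier_vecI)
  moreover have "i < length (cols B @ cols C)"
    using carrier_matD[OF B] carrier_matD[OF C] i by simp
  ultimately show ?thesis using col_mat_of_cols by metis
qed

lemma mat_of_cols_append_carrier:
  assumes B: "B \<in> carrier_mat n b" and C: "C \<in> carrier_mat n c"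
  shows "mat_of_cols n (cols B @ cols C) \<in> carrier_mat n (b + c)"
  using mat_of_cols_carrier(1)[of n "cols B @ cols C"] carrier_matD(2)[OF B] carrier_matD(2)[OF C]
  by simp

lemma transpose_mat_of_cols_append_mult:
  fixes B C :: "real mat"
  assumes B: "B \<in> carrier_mat n b" and C: "C \<in> carrier_mat n c"
  shows "(mat_of_cols n (cols B @ cols C))\<^sup>T *\<^sub>v z = (B\<^sup>T *\<^sub>v z) @\<^sub>v (C\<^sup>T *\<^sub>v z)"
proof (rule eq_vecI)
  note dims = carrier_matD[OF B] carrier_matD[OF C] carrier_matD[OF mat_of_cols_append_carrier[OF B C]]
  show "dim_vec ((mat_of_cols n (cols B @ cols C))\<^sup>T *\<^sub>v z) = dim_vec ((B\<^sup>T *\<^sub>v z) @\<^sub>v (C\<^sup>T *\<^sub>v z))"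
    using dims by simp
  fix i assume "i < dim_vec ((B\<^sup>T *\<^sub>v z) @\<^sub>v (C\<^sup>T *\<^sub>v z))"
  then have i: "i < b + c" using dims by simp
  show "((mat_of_cols n (cols B @ cols C))\<^sup>T *\<^sub>v z) $ i = ((B\<^sup>T *\<^sub>v z) @\<^sub>v (C\<^sup>T *\<^sub>v z)) $ i"
    using i dims col_mat_of_cols_append[OF B C i] by auto
qed

lemma orthonormal_cols_append_left:
  assumes B: "B \<in> carrier_mat n b" and C: "C \<in> carrier_mat n c"
    and o: "orthonormal_cols (mat_of_cols n (cols B @ cols C))"
  shows "orthonormal_cols B"
  using o col_mat_of_cols_append[OF B C]
  unfolding orthonormal_cols_iff[OF mat_of_cols_append_carrier[OF B C]] orthonormal_cols_iff[OF B]
  by (metis trans_less_add1)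

lemma map_diag_entry_nonzero_of_invertible:
  assumes D: "D \<in> carrier_mat k k" and inv: "invertible_mat (map_diag f D)" and i: "i < k"
  shows "f (D $$ (i, i)) \<noteq> 0"
proof
  assume 0: "f (D $$ (i, i)) = 0"
  obtain B where B: "map_diag f D * B = 1\<^sub>m k" "B * map_diag f D = 1\<^sub>m (dim_row B)"
    using inv D unfolding invertible_mat_def inverts_mat_def by (auto simp: map_diag_def)
  have "dim_col B = k" using arg_cong[OF B(1), of dim_col] by simp
  have Bc: "dim_row B = k" using arg_cong[OF B(2), of dim_col] D by (simp add: map_diag_def)
  have "row (map_diag f D) i = 0\<^sub>v k"
    using D i 0 unfolding map_diag_def by (intro eq_vecI) auto
  then have "(map_diag f D * B) $$ (i, i) = 0"
    using map_diag_carrier[OF D, of f] i carrier_vecI[of "col B i" k] Bc \<open>dim_col B = k\<close> by simp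
  then show False using B(1) i by simp
qed

text \<open>The sine of the angle between a unit vector \<open>u\<close> and a subspace is the distance from \<open>u\<close> to the
  subspace. The point \<open>z\<close> with \<open>u \<bullet> z = 1\<close> also shows that the subspace is not zero, so that there is
  an angle at all.\<close>

lemma sin_angle_le_dist:
  assumes N: "N \<in> carrier_mat m l" and u: "u \<in> carrier_vec m" and u1: "u \<bullet> u = 1"
    and z: "z \<in> mat_range N" and uz: "u \<bullet> z = 1"
  shows "\<bar>sin (principal_angles m (mat_range N) (vec_span m {u}) $$ (0, 0))\<bar> \<le> vec_norm2 (u - z)"
proof -
  obtain c Q where Q: "Q \<in> carrier_mat m c" "orthonormal_cols Q" and QN: "mat_range Q = mat_range N"
    using ex_orthonormal_basis_of_range[OF N] by blast
  have c: "1 \<le> c"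
  proof (rule ccontr)
    assume "\<not> 1 \<le> c"
    then have "c = 0" by simp
    obtain x where "x \<in> carrier_vec c" "z = Q *\<^sub>v x"
      using z Q unfolding QN[symmetric] unfolding mat_range_eq by auto
    then have "u \<bullet> z = (Q\<^sup>T *\<^sub>v u) \<bullet> x" using transpose_vec_mult_scalar[OF Q(1) _ u] by simp
    also have "\<dots> = 0" using \<open>x \<in> carrier_vec c\<close> \<open>c = 0\<close> by (simp add: scalar_prod_def)
    finally show False using uz by simp
  qed
  let ?W = "mat_of_cols m [u]"
  have W: "?W \<in> carrier_mat m 1" by (simp add: carrier_matI)
  have colW: "col ?W 0 = u" using u by (subst col_mat_of_cols) auto
  have oW: "orthonormal_cols ?W" unfolding orthonormal_cols_iff[OF W] using colW u1 by simp
  have span: "vec_span m {u} = mat_range ?W"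
  proof -
    interpret vec_space "TYPE(real)" m .
    have "cols ?W = [u]" using u by (intro cols_mat_of_cols) simp
    then show ?thesis by (simp add: col_space_def)
  qed
  have Wx: "?W *\<^sub>v x = x $ 0 \<cdot>\<^sub>v u" if "x \<in> carrier_vec 1" for x
    using u that by (intro eq_vecI) (auto simp: scalar_prod_def mat_of_cols_index)
  have one: "(0 :: nat) < 1" by simp
  obtain \<sigma> x where \<sigma>: "0 \<le> \<sigma>" and ang: "principal_angles m (mat_range Q) (mat_range ?W) $$ (1 - 1, 1 - 1) = arccos \<sigma>"
    and x: "x \<in> carrier_vec 1" "vec_norm2 x = 1" "vec_norm2 (Q\<^sup>T *\<^sub>v (?W *\<^sub>v x)) = \<sigma>"
    using largest_principal_angle(2)[OF Q W oW one c] by blast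
  have "\<bar>x $ 0\<bar> = 1"
    using x(1,2) by (simp add: vec_norm2_def scalar_prod_def)
  then have \<sigma>Q: "\<sigma> = vec_norm2 (Q\<^sup>T *\<^sub>v u)"
    using x(3) unfolding Wx[OF x(1)] using mult_mat_vec[of "Q\<^sup>T" c m u "x $ 0"] Q u
    by (simp add: vec_norm2_smult)
  have "\<sigma> \<le> 1" using projection_norm_le[OF Q u] u1 \<sigma>Q by (simp add: vec_norm2_def)
  then have "sin (arccos \<sigma>) = sqrt (1 - \<sigma>\<^sup>2)" "\<sigma>\<^sup>2 \<le> 1"
    using \<sigma> by (auto intro: sin_arccos power_le_one)
  moreover have "1 - \<sigma>\<^sup>2 \<le> (u - z) \<bullet> (u - z)"
    using dist_to_range_ge[OF Q u, of z] z QN u1 vec_norm2_sq[of "Q\<^sup>T *\<^sub>v u"] \<sigma>Q by simp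
  ultimately have "\<bar>sin (arccos \<sigma>)\<bar> \<le> vec_norm2 (u - z)" unfolding vec_norm2_def by simp
  then show ?thesis using ang unfolding span QN by simp
qed

theorem theorem2p2:
  fixes A X U \<Sigma> V \<Sigma>\<^sub>k \<Sigma>\<^sub>p V\<^sub>k V\<^sub>p :: "real mat" and \<phi> :: "real poly" and m n s q k :: nat
  assumes A: "A \<in> carrier_mat m n"
    and X: "X \<in> carrier_mat n s"
    and dim_K: "subspace_dim m (mat_range (krylov_mat A X q)) = (q + 1) * s"
    and svd: "is_full_svd A U \<Sigma> V"
    and k: "1 \<le> k" "k < vec_space.rank m A"
    and \<Sigma>_part: "\<Sigma>\<^sub>k \<in> carrier_mat k k" "\<Sigma>\<^sub>p \<in> carrier_mat (m - k) (n - k)"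
      "\<Sigma> = four_block_mat \<Sigma>\<^sub>k (0\<^sub>m k (n - k)) (0\<^sub>m (m - k) k) \<Sigma>\<^sub>p"
    and V_part: "V\<^sub>k \<in> carrier_mat n k" "V\<^sub>p \<in> carrier_mat n (n - k)"
      "V = mat_of_cols n (cols V\<^sub>k @ cols V\<^sub>p)"
    and gap: "\<Sigma> $$ (k - 1, k - 1) > \<Sigma> $$ (k, k)" "\<Sigma> $$ (k, k) > 0"
    and \<phi>_deg: "degree \<phi> = 2 * q + 1"
    and \<phi>_odd: "\<And>j. even j \<Longrightarrow> coeff \<phi> j = 0"
    and \<phi>_nonsing: "invertible_mat (map_diag (poly \<phi>) \<Sigma>\<^sub>k)"
    and rank: "vec_space.rank k (transpose_mat V\<^sub>k * X) = k"
  shows "(\<forall>i<k.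
            \<bar>sin (principal_angles m (mat_range (krylov_mat A X q)) (vec_span m {col U i}) $$ (0,0))\<bar>
            \<le> spectral_norm (map_diag (poly \<phi>) \<Sigma>\<^sub>p) / \<bar>poly \<phi> (\<Sigma> $$ (i,i))\<bar>
              * spectral_norm (transpose_mat V\<^sub>p * X * pinv (transpose_mat V\<^sub>k * X)))
       \<and> (orthonormal_cols X \<longrightarrow> (\<forall>i<k.
            \<bar>sin (principal_angles m (mat_range (krylov_mat A X q)) (vec_span m {col U i}) $$ (0,0))\<bar>
            \<le> spectral_norm (map_diag (poly \<phi>) \<Sigma>\<^sub>p) / \<bar>poly \<phi> (\<Sigma> $$ (i,i))\<bar>
              * spectral_norm (map_diag tan (principal_angles n (mat_range X) (mat_range V\<^sub>k)))))"
proof -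
  have U: "U \<in> carrier_mat m m" "orthonormal_cols U"
    and V: "V \<in> carrier_mat n n" "orthonormal_cols V"
    and \<Sigma>: "\<Sigma> \<in> carrier_mat m n" "diagonal_mat \<Sigma>"
    using svd A unfolding is_full_svd_def by auto
  have "\<Sigma> \<in> carrier_mat (k + (m - k)) (k + (n - k))"
    unfolding \<Sigma>_part(3) by (rule four_block_carrier_mat[OF \<Sigma>_part(1,2)])
  then have "m = k + (m - k)" "n = k + (n - k)"
    using \<Sigma>(1) by (metis carrier_matD(1), metis carrier_matD(2))
  then have kmn: "k \<le> m" "k \<le> n" by linarith+
  have split_n: "k + (n - k) = n" using kmn by simp
  let ?G = "V\<^sub>k\<^sup>T * X"
  have G: "?G \<in> carrier_mat k s" using V_part X by simp
  have ks: "k \<le> s"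
  proof -
    interpret vec_space "TYPE(real)" k .
    show ?thesis using rank_le_nc[OF G] rank by simp
  qed
  obtain H where H: "H \<in> carrier_mat k k" "pinv ?G = ?G\<^sup>T * H" "?G * (?G\<^sup>T * H) = 1\<^sub>m k"
    using pinv_full_row_rank(1)[OF G rank] by blast
  define P where "P = pinv ?G"
  have P: "P \<in> carrier_mat s k" 
    unfolding P_def H(2) by (rule mult_carrier_mat[OF _ H(1)]) (use G in \<open>simp only: transpose_carrier_mat\<close>)
  have GPy: "?G *\<^sub>v (P *\<^sub>v y) = y" if "y \<in> carrier_vec k" for y
    using assoc_mult_mat_vec[OF G P that] H(3) that unfolding P_def H(2) by simp
  define T where "T = V\<^sub>p\<^sup>T * X * P"
  have T: "T \<in> carrier_mat (n - k) k" unfolding T_def using V_part X P by simp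
  have Ty: "T *\<^sub>v y = V\<^sub>p\<^sup>T *\<^sub>v (X *\<^sub>v (P *\<^sub>v y))" if "y \<in> carrier_vec k" for y
    using V_part X P that unfolding T_def
    by (simp add: assoc_mult_mat[of _ "n - k" n _ s _ k] assoc_mult_mat_vec[of _ "n - k" n _ k]
        assoc_mult_mat_vec[of _ n s _ k])
  have VXP: "V\<^sup>T *\<^sub>v (X *\<^sub>v (P *\<^sub>v y)) = y @\<^sub>v T *\<^sub>v y" if y: "y \<in> carrier_vec k" for y
  proof -
    have Py: "P *\<^sub>v y \<in> carrier_vec s" using P y by simp
    have "V\<^sup>T *\<^sub>v (X *\<^sub>v (P *\<^sub>v y)) = (V\<^sub>k\<^sup>T *\<^sub>v (X *\<^sub>v (P *\<^sub>v y))) @\<^sub>v (V\<^sub>p\<^sup>T *\<^sub>v (X *\<^sub>v (P *\<^sub>v y)))"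
      unfolding V_part(3) by (rule transpose_mat_of_cols_append_mult[OF V_part(1,2)])
    also have "V\<^sub>k\<^sup>T *\<^sub>v (X *\<^sub>v (P *\<^sub>v y)) = y"
      using GPy[OF y] V_part X Py by (simp add: assoc_mult_mat_vec[of _ k n _ s])
    finally show ?thesis using Ty[OF y] by simp
  qed
  define D where "D = map_diag (poly \<phi>) \<Sigma>\<^sub>p"
  have D: "D \<in> carrier_mat (m - k) (n - k)" unfolding D_def using \<Sigma>_part by simp
  have \<phi>0: "poly \<phi> (\<Sigma> $$ (i, i)) \<noteq> 0" if "i < k" for i
  proof -
    have "\<Sigma> $$ (i, i) = \<Sigma>\<^sub>k $$ (i, i)" using that \<Sigma>_part by auto
    then show ?thesis using map_diag_entry_nonzero_of_invertible[OF \<Sigma>_part(1) \<phi>_nonsing that] by simp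
  qed
  let ?K = "mat_range (krylov_mat A X q)"
  let ?ang = "\<lambda>i. principal_angles m ?K (vec_span m {col U i})"
  have first: "\<bar>sin (?ang i $$ (0, 0))\<bar>
      \<le> spectral_norm D / \<bar>poly \<phi> (\<Sigma> $$ (i, i))\<bar> * spectral_norm T" if i: "i < k" for i
  proof -
    define a where "a = poly \<phi> (\<Sigma> $$ (i, i))"
    have a: "a \<noteq> 0" unfolding a_def by (rule \<phi>0[OF i])
    let ?e = "unit_vec k i"
    have e: "?e \<in> carrier_vec k" by simp
    have Te: "T *\<^sub>v ?e \<in> carrier_vec (n - k)" using T by simp
    define d where "d = (1 / a) \<cdot>\<^sub>v (D *\<^sub>v (T *\<^sub>v ?e))"
    have d: "d \<in> carrier_vec (m - k)" unfolding d_def using D Te by simp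
    have ed: "?e @\<^sub>v d \<in> carrier_vec m" using append_carrier_vec[OF e d] kmn by simp
    \<comment> \<open>\<open>z\<close> is \<open>u\<^sub>i\<close> plus the combination of \<open>u\<^sub>k\<^sub>+\<^sub>1, \<dots>, u\<^sub>m\<close> with coefficients \<open>d\<close>; it lies in the
      Krylov space, at distance \<open>\<parallel>d\<parallel>\<close> from \<open>u\<^sub>i\<close>.\<close>
    define z where "z = U *\<^sub>v (?e @\<^sub>v d)"
    \<comment> \<open>With the blocks \<open>\<Sigma>\<^sub>k\<close> and \<open>\<Sigma>\<^sub>p\<close>, \<open>\<phi>(\<Sigma>)\<close> maps \<open>(e\<^sub>i, T e\<^sub>i)\<close> to \<open>(\<phi>(\<sigma>\<^sub>i) e\<^sub>i, D T e\<^sub>i)\<close>.\<close>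
    have "map_diag (poly \<phi>) \<Sigma> *\<^sub>v (?e @\<^sub>v T *\<^sub>v ?e) = a \<cdot>\<^sub>v (?e @\<^sub>v d)"
    proof (rule eq_vec_carrierI[of _ m])
      have eT: "?e @\<^sub>v T *\<^sub>v ?e \<in> carrier_vec n" using append_carrier_vec[OF e Te] split_n by simp
      show "map_diag (poly \<phi>) \<Sigma> *\<^sub>v (?e @\<^sub>v T *\<^sub>v ?e) \<in> carrier_vec m"
        by (rule mult_mat_vec_carrier[OF _ eT]) (use \<Sigma> in simp)
      show "a \<cdot>\<^sub>v (?e @\<^sub>v d) \<in> carrier_vec m" using ed by simp
      fix l assume l: "l < m"
      have left: "(map_diag (poly \<phi>) \<Sigma> *\<^sub>v (?e @\<^sub>v T *\<^sub>v ?e)) $ l =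
          (if l < n then poly \<phi> (\<Sigma> $$ (l, l)) * (?e @\<^sub>v T *\<^sub>v ?e) $ l else 0)"
        by (rule map_diag_mult_vec[OF \<Sigma>(1) eT l])
      show "(map_diag (poly \<phi>) \<Sigma> *\<^sub>v (?e @\<^sub>v T *\<^sub>v ?e)) $ l = (a \<cdot>\<^sub>v (?e @\<^sub>v d)) $ l"
      proof (cases "l < k")
        case True
        then show ?thesis
          unfolding left using kmn l T d i by (auto simp: a_def unit_vec_def simp del: index_mult_mat_vec)
      next
        case False
        have lk: "l - k < m - k" using False l by simp
        have S: "\<Sigma> $$ (l, l) = \<Sigma>\<^sub>p $$ (l - k, l - k)" if "l < n"
          using that False l \<Sigma>_part by simp
        have "(D *\<^sub>v (T *\<^sub>v ?e)) $ (l - k) =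
            (if l - k < n - k then poly \<phi> (\<Sigma>\<^sub>p $$ (l - k, l - k)) * (T *\<^sub>v ?e) $ (l - k) else 0)"
          unfolding D_def by (rule map_diag_mult_vec[OF \<Sigma>_part(2) Te lk])
        moreover have "(a \<cdot>\<^sub>v (?e @\<^sub>v d)) $ l = (D *\<^sub>v (T *\<^sub>v ?e)) $ (l - k)"
          unfolding d_def using False l lk a D Te kmn
          by (simp del: index_mult_mat_vec)
        moreover have "l < n \<longleftrightarrow> l - k < n - k" using False kmn by linarith
        moreover have "(?e @\<^sub>v T *\<^sub>v ?e) $ l = (T *\<^sub>v ?e) $ (l - k)" if "l < n"
          using that False Te kmn T by (simp del: index_mult_mat_vec)
        ultimately show ?thesis unfolding left using S by simp
      qed
    qed
    then have "U *\<^sub>v (map_diag (poly \<phi>) \<Sigma> *\<^sub>v (V\<^sup>T *\<^sub>v (X *\<^sub>v (P *\<^sub>v ?e)))) = a \<cdot>\<^sub>v z"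
      unfolding VXP[OF e] z_def using mult_mat_vec[OF U(1) ed] by simp
    moreover have "U *\<^sub>v (map_diag (poly \<phi>) \<Sigma> *\<^sub>v (V\<^sup>T *\<^sub>v (X *\<^sub>v (P *\<^sub>v ?e)))) \<in> ?K"
      by (rule odd_poly_mem_krylov[OF A X _ svd]) (use \<phi>_deg \<phi>_odd P in auto)
    ultimately have azK: "a \<cdot>\<^sub>v z \<in> ?K" by simp
    obtain N where K: "krylov_mat A X q \<in> carrier_mat m N"
      unfolding krylov_mat_def carrier_matD(1)[OF A] using mat_of_cols_carrier(1) by blast
    have "(1 / a) \<cdot>\<^sub>v (a \<cdot>\<^sub>v z) = z" using a by (simp add: smult_smult_assoc)
    then have zK: "z \<in> ?K" using mat_range_smult[OF K azK, of "1 / a"] by simp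
    have zc: "z \<in> carrier_vec m" unfolding z_def using U ed by simp
    have uc: "col U i \<in> carrier_vec m" using carrier_matD[OF U(1)] by (intro carrier_vecI) simp
    have dist: "(col U i - z) \<bullet> (col U i - z) = d \<bullet> d"
    proof -
      let ?u = "unit_vec m i"
      have "col U i - z = U *\<^sub>v (?u - (?e @\<^sub>v d))"
        unfolding z_def using col_eq_mult_unit_vec[OF U(1), of i] i kmn
          mult_minus_distrib_mat_vec[OF U(1) unit_vec_carrier ed] by simp
      then have "(col U i - z) \<bullet> (col U i - z) = (?u - (?e @\<^sub>v d)) \<bullet> (?u - (?e @\<^sub>v d))"
        using orthonormal_cols_isometry[OF U, of "?u - (?e @\<^sub>v d)"] vec_norm2_sq ed
        by (metis minus_carrier_vec unit_vec_carrier)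
      also have "?u - (?e @\<^sub>v d) = 0\<^sub>v k @\<^sub>v (- d)"
        using kmn d i by (intro eq_vecI) (auto simp: unit_vec_def)
      also have "\<dots> \<bullet> \<dots> = d \<bullet> d"
        using d by (simp add: scalar_prod_append[of _ k _ "m - k"])
      finally show ?thesis .
    qed
    have d_le: "vec_norm2 d \<le> spectral_norm D / \<bar>a\<bar> * spectral_norm T"
    proof -
      have "vec_norm2 (D *\<^sub>v (T *\<^sub>v ?e)) \<le> spectral_norm D * vec_norm2 (T *\<^sub>v ?e)"
        by (rule spectral_norm_bound[OF D Te])
      also have "vec_norm2 (T *\<^sub>v ?e) \<le> spectral_norm T"
        using spectral_norm_bound[OF T e] i by (simp add: vec_norm2_def)
      finally have "vec_norm2 (D *\<^sub>v (T *\<^sub>v ?e)) \<le> spectral_norm D * spectral_norm T"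
        using spectral_norm_nonneg[OF D] by (simp add: mult_left_mono)
      then show ?thesis unfolding d_def by (simp add: vec_norm2_smult divide_right_mono)
    qed
    have uz: "col U i \<bullet> z = 1"
    proof -
      have "col U i \<bullet> z = (U\<^sup>T *\<^sub>v z) $ i" using U i kmn by simp
      also have "U\<^sup>T *\<^sub>v z = ?e @\<^sub>v d" unfolding z_def by (rule orthonormal_cols_transpose_mult[OF U ed])
      finally show ?thesis using i d kmn by simp
    qed
    have "\<bar>sin (?ang i $$ (0, 0))\<bar> \<le> vec_norm2 (col U i - z)"
      by (rule sin_angle_le_dist[OF K uc _ zK uz])
        (use orthonormal_cols_iff[OF U(1)] U i kmn in simp)
    also have "\<dots> = vec_norm2 d" unfolding vec_norm2_def dist ..
    also note d_le
    finally show ?thesis unfolding a_def .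
  qed
  have second: "spectral_norm T
      \<le> spectral_norm (map_diag tan (principal_angles n (mat_range X) (mat_range V\<^sub>k)))"
    if oX: "orthonormal_cols X"
  proof -
    have oV: "orthonormal_cols V\<^sub>k"
      by (rule orthonormal_cols_append_left[OF V_part(1,2)]) (use V(2) V_part(3) in simp)
    let ?P = "principal_angles n (mat_range X) (mat_range V\<^sub>k)"
    have k0: "0 < k" using k by simp
    note ang = largest_principal_angle[OF X oX V_part(1) oV k0 ks]
    obtain \<sigma> where \<sigma>: "0 \<le> \<sigma>" "?P $$ (k - 1, k - 1) = arccos \<sigma>"
      "\<And>x. x \<in> carrier_vec k \<Longrightarrow> \<sigma> * vec_norm2 x \<le> vec_norm2 (X\<^sup>T *\<^sub>v (V\<^sub>k *\<^sub>v x))"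
      "\<exists>x\<in>carrier_vec k. vec_norm2 x = 1 \<and> vec_norm2 (X\<^sup>T *\<^sub>v (V\<^sub>k *\<^sub>v x)) = \<sigma>"
      using ang(2) by blast
    have GT: "?G\<^sup>T *\<^sub>v x = X\<^sup>T *\<^sub>v (V\<^sub>k *\<^sub>v x)" if "x \<in> carrier_vec k" for x
      using X V_part(1) that
      by (simp add: transpose_mult[of _ k n _ s] assoc_mult_mat_vec[of _ s n _ k])
    obtain x0 where x0: "x0 \<in> carrier_vec k" "vec_norm2 x0 = 1" "vec_norm2 (X\<^sup>T *\<^sub>v (V\<^sub>k *\<^sub>v x0)) = \<sigma>"
      using \<sigma>(4) by blast
    have "\<sigma> \<noteq> 0"
    proof
      assume "\<sigma> = 0"
      then have "?G\<^sup>T *\<^sub>v x0 = 0\<^sub>v s"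
        using x0 GT[OF x0(1)] vec_norm2_eq_0[of "X\<^sup>T *\<^sub>v (V\<^sub>k *\<^sub>v x0)" s] X V_part(1)
        by simp
      then have "x0 = 0\<^sub>v k" by (rule pinv_full_row_rank(2)[OF G rank x0(1)])
      then show False using x0(2) by (simp add: vec_norm2_def)
    qed
    then have \<sigma>0: "0 < \<sigma>" using \<sigma>(1) by simp
    have \<sigma>1: "\<sigma> \<le> 1"
      using projection_norm_le[OF X oX, of "V\<^sub>k *\<^sub>v x0"] orthonormal_cols_isometry[OF V_part(1) oV x0(1)]
        x0 V_part(1) by simp
    define \<tau> where "\<tau> = sqrt (1 - \<sigma>\<^sup>2) / \<sigma>"
    have \<tau>: "tan (arccos \<sigma>) = \<tau>"
      unfolding \<tau>_def tan_def using \<sigma>0 \<sigma>1 by (simp add: sin_arccos)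
    have \<sigma>sq: "\<sigma>\<^sup>2 \<le> 1" using \<sigma>0 \<sigma>1 by (simp add: power_le_one)
    have \<tau>0: "0 \<le> \<tau>" unfolding \<tau>_def using \<sigma>0 \<sigma>sq by simp
    have "spectral_norm T \<le> \<tau>"
    proof (rule spectral_norm_le[OF T \<tau>0])
      fix y :: "real vec" assume y: "y \<in> carrier_vec k"
      define w where "w = H *\<^sub>v y"
      have w: "w \<in> carrier_vec k" unfolding w_def using H y by simp
      have Py: "P *\<^sub>v y \<in> carrier_vec s" using P y by simp
      have GTc: "?G\<^sup>T \<in> carrier_mat s k" using G by (simp only: transpose_carrier_mat)
      have Pyw: "P *\<^sub>v y = ?G\<^sup>T *\<^sub>v w"
        unfolding P_def H(2) w_def by (rule assoc_mult_mat_vec[OF GTc H(1) y])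
      let ?p = "vec_norm2 (P *\<^sub>v y)"
      \<comment> \<open>With \<open>P y = G\<^sup>T w\<close>: \<open>\<parallel>P y\<parallel>\<^sup>2 = w \<bullet> y \<le> \<parallel>w\<parallel> \<parallel>y\<parallel>\<close> and \<open>\<sigma> \<parallel>w\<parallel> \<le> \<parallel>G\<^sup>T w\<parallel> = \<parallel>P y\<parallel>\<close> give
        \<open>\<sigma> \<parallel>P y\<parallel> \<le> \<parallel>y\<parallel>\<close>.\<close>
      have "(P *\<^sub>v y) \<bullet> (P *\<^sub>v y) = w \<bullet> y"
        using transpose_vec_mult_scalar[OF G Py w] GPy[OF y] Pyw by simp
      then have "?p\<^sup>2 \<le> vec_norm2 w * vec_norm2 y"
        using Cauchy_Schwarz_vec[OF w y] vec_norm2_sq[of "P *\<^sub>v y"] by simp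
      then have "\<sigma> * ?p\<^sup>2 \<le> (\<sigma> * vec_norm2 w) * vec_norm2 y" using \<sigma>0 by simp
      also have "\<dots> \<le> ?p * vec_norm2 y"
        using \<sigma>(3)[OF w] GT[OF w] Pyw by (intro mult_right_mono) auto
      finally have "?p * (\<sigma> * ?p) \<le> ?p * vec_norm2 y" by (simp add: power2_eq_square mult_ac)
      then have "\<sigma> * ?p \<le> vec_norm2 y"
        by (cases "?p = 0") (use vec_norm2_nonneg[of "P *\<^sub>v y"] in \<open>auto simp: mult_le_cancel_left\<close>)
      then have p_le: "\<sigma>\<^sup>2 * ?p\<^sup>2 \<le> (vec_norm2 y)\<^sup>2"
        using \<sigma>0 power_mono[of "\<sigma> * ?p" "vec_norm2 y" 2] by (simp add: power_mult_distrib)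
      have XPy: "X *\<^sub>v (P *\<^sub>v y) \<in> carrier_vec n" using X Py by simp
      \<comment> \<open>\<open>X\<close> and \<open>V\<^sup>T\<close> preserve lengths, and \<open>V\<^sup>T X P y\<close> consists of \<open>y\<close> and \<open>T y\<close>.\<close>
      have "?p\<^sup>2 = (vec_norm2 (V\<^sup>T *\<^sub>v (X *\<^sub>v (P *\<^sub>v y))))\<^sup>2"
        using orthonormal_cols_isometry[OF X oX Py]
          orthonormal_cols_isometry[OF _ square_orthonormal_cols(2)[OF V] XPy] V by simp
      also have "\<dots> = (vec_norm2 y)\<^sup>2 + (vec_norm2 (T *\<^sub>v y))\<^sup>2"
        unfolding VXP[OF y] vec_norm2_sq using y T by (intro scalar_prod_append[of _ k _ "n - k"]) auto
      finally have py: "?p\<^sup>2 = (vec_norm2 y)\<^sup>2 + (vec_norm2 (T *\<^sub>v y))\<^sup>2" .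
      have "\<sigma>\<^sup>2 * (vec_norm2 (T *\<^sub>v y))\<^sup>2 \<le> (1 - \<sigma>\<^sup>2) * (vec_norm2 y)\<^sup>2"
        using p_le unfolding py by (simp add: algebra_simps)
      also have "1 - \<sigma>\<^sup>2 = (\<sigma> * \<tau>)\<^sup>2" unfolding \<tau>_def using \<sigma>0 \<sigma>sq by simp
      finally have "(\<sigma> * vec_norm2 (T *\<^sub>v y))\<^sup>2 \<le> (\<sigma> * (\<tau> * vec_norm2 y))\<^sup>2"
        by (simp add: power_mult_distrib mult_ac)
      then have "\<sigma> * vec_norm2 (T *\<^sub>v y) \<le> \<sigma> * (\<tau> * vec_norm2 y)"
        by (rule power2_le_imp_le) (use \<sigma>0 \<tau>0 in simp)
      then show "vec_norm2 (T *\<^sub>v y) \<le> \<tau> * vec_norm2 y" using \<sigma>0 by simp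
    qed
    also have "\<tau> = map_diag tan ?P $$ (k - 1, k - 1)"
      using ang(1) \<tau> \<sigma>(2) k0 unfolding map_diag_def by simp
    also have "\<dots> \<le> spectral_norm (map_diag tan ?P)"
      using abs_diag_entry_le_spectral_norm[of "map_diag tan ?P" k "k - 1"] ang(1) k0 by simp
    finally show ?thesis .
  qed
  show ?thesis
  proof (intro conjI allI impI)
    fix i assume i: "i < k"
    show "\<bar>sin (?ang i $$ (0, 0))\<bar> \<le> spectral_norm (map_diag (poly \<phi>) \<Sigma>\<^sub>p) / \<bar>poly \<phi> (\<Sigma> $$ (i, i))\<bar>
        * spectral_norm (V\<^sub>p\<^sup>T * X * pinv ?G)"
      using first[OF i] unfolding D_def T_def P_def .
  next
    fix i assume oX: "orthonormal_cols X" and i: "i < k"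
    have "spectral_norm D / \<bar>poly \<phi> (\<Sigma> $$ (i, i))\<bar> * spectral_norm T \<le>
        spectral_norm D / \<bar>poly \<phi> (\<Sigma> $$ (i, i))\<bar> *
        spectral_norm (map_diag tan (principal_angles n (mat_range X) (mat_range V\<^sub>k)))"
      using second[OF oX] spectral_norm_nonneg[OF D] by (intro mult_left_mono) auto
    with first[OF i] show "\<bar>sin (?ang i $$ (0, 0))\<bar>
        \<le> spectral_norm (map_diag (poly \<phi>) \<Sigma>\<^sub>p) / \<bar>poly \<phi> (\<Sigma> $$ (i, i))\<bar>
        * spectral_norm (map_diag tan (principal_angles n (mat_range X) (mat_range V\<^sub>k)))"
      unfolding D_def by linarith
  qed
qed

end
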